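(* Let $K$, $\mathcal{E}$, $\mu$, the finite set $E\subset K$, $\Delta_\mu$, the weights $\{p(x)\}_{x\in E}$, and $\delta_0(E),\delta_1(E)$ be as in the context. (a) If $u\in\operatorname{dom}\mathcal{E}$, then $$\left|\int_K u\,d\mu-\sum_{x\in E}p(x)u(x)\right|\le\delta_0(E)\,\mathcal{E}(u)^{1/2}.$$ (b) If $u\in\operatorname{dom}_{L^1}\Delta_\mu$, then $$\left|\int_K u\,d\mu-\sum_{x\in E}p(x)u(x)\right|\le\delta_1(E)\int_K|\Delta_\mu u|\,d\mu.$$
   Context: $K$ is a p.c.f. (post-critically finite) self-similar fractal in the sense of Kigami, generated by a finite family $\{F_i\}$ of contractive similarities of a Euclidean space: $K=\bigcup_i F_iK$, and there is a finite boundary set $V_0\subset K$ with $F_iK\cap F_jK\subseteq F_iV_0\cap F_jV_0$ for $i\ne j$. $K$ carries a regular harmonic structure, i.e. a self-similar energy (local regular Dirichlet form) $\mathcal{E}(u,v)$ with domain $\operatorname{dom}\mathcal{E}=\{u:\mathcal{E}(u)<\infty\}\subset C(K)$, where $\mathcal{E}(u)=\mathcal{E}(u,u)=\sum_i r_i^{-1}\mathcal{E}(u\circ F_i)$ with constants $0<r_i<1$. $\mu$ is a non-atomic Borel probability measure on $K$ that is positive on nonempty open sets. $E\subset K$ is a finite nonempty set. Laplacian: for $u\in\operatorname{dom}\mathcal{E}$, $\Delta_\mu u$ is defined by the weak formulation $\int_K v\,\Delta_\mu u\,d\mu=-\mathcal{E}(u,v)$ for all $v\in\operatorname{dom}\mathcal{E}$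 (if $V_0\subseteq E$, it may be required only for those $v$ vanishing on $V_0$). $\operatorname{dom}_{L^1}\Delta_\mu$ is the space of $u$ for which $\Delta_\mu u$ exists in $L^1(d\mu)$. Green's function: $G_E(x,y)$ is the (symmetric, $\mu$-independent) Green's function with Dirichlet conditions on $E$: for suitable $f$, $F(x)=\int_K G_E(x,y)f(y)\,d\mu(y)$ is the unique solution of $-\Delta_\mu F=f$, $F|_E=0$, i.e. the unique $F\in\operatorname{dom}\mathcal{E}$ with $F|_E=0$ and $\mathcal{E}(F,v)=\int_K fv\,d\mu$ for all $v\in\operatorname{dom}\mathcal{E}$ vanishing on $E$. Put $g_E(x)=\int_K G_E(x,y)\,d\mu(y)$, $\delta_0(E)=\left(\int_K g_E\,d\mu\right)^{1/2}$ and $\delta_1(E)=\sup_{x\in K}g_E(x)$. Weights: $\mathcal{H}_E$ is the $\#E$-dimensional space of piecewise harmonic splines with nodes in $E$: continuous $v$ with $\Delta_\mu v=0$ on $K\setminus E$ (with vanishing normal derivative at points of $V_0\setminus E$); equivalently, $v\in\operatorname{dom}\mathcal{E}$ with $\mathcal{E}(v,\varphi)=0$ for all $\varphi\in\operatorname{dom}\mathcal{E}$ with $\varphi|_E=0$. Each $v\in\mathcal{H}_E$ is determined by its values on $E$. For $x\in E$, let $v_x\in\mathcal{H}_E$ satisfy $v_x(x)=1$ and $v_x=0$ on $E\setminus\{x\}$, and put $p(x)=\int_K v_x\,d\mu$; these are the unique weights with $\int_K v\,d\mu=\sum_{x\in E}p(x)v(x)$ for all $v\in\mathcal{H}_E$.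 *)

theory Defs
  imports "HOL-Analysis.Analysis" "HOL-Probability.Probability_Measure"
begin

section \<open>Post-critically finite self-similar sets\<close>

definition contractive_similarity :: "('a::metric_space \<Rightarrow> 'a) \<Rightarrow> bool" where
  "contractive_similarity f \<longleftrightarrow>
     (\<exists>\<rho>. 0 < \<rho> \<and> \<rho> < 1 \<and> (\<forall>x y. dist (f x) (f y) = \<rho> * dist x y))"

text \<open>A finite word \<open>w = [w\<^sub>1, \<dots>, w\<^sub>m]\<close> acts by \<open>foldr F w = F w\<^sub>1 \<circ> \<dots> \<circ> F w\<^sub>m\<close>.
  \<open>coding K F \<omega>\<close> is Kigami's projection: the single point lying in all the cells that
  are indexed by the initial segments of the infinite word \<open>\<omega>\<close>.\<close>

definition coding :: "'a set \<Rightarrow> ('i \<Rightarrow> 'a \<Rightarrow> 'a) \<Rightarrow> (nat \<Rightarrow> 'i) \<Rightarrow> 'a" where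
  "coding K F \<omega> = (THE x. \<forall>m. x \<in> foldr F (map \<omega> [0..<m]) ` K)"

definition critical_set :: "'a set \<Rightarrow> ('i \<Rightarrow> 'a \<Rightarrow> 'a) \<Rightarrow> (nat \<Rightarrow> 'i) set" where
  "critical_set K F = {\<omega>. \<exists>i j. i \<noteq> j \<and> coding K F \<omega> \<in> F i ` K \<inter> F j ` K}"

definition post_critical_set :: "'a set \<Rightarrow> ('i \<Rightarrow> 'a \<Rightarrow> 'a) \<Rightarrow> (nat \<Rightarrow> 'i) set" where
  "post_critical_set K F = {\<lambda>k. \<omega> (k + n) | \<omega> n. n \<ge> 1 \<and> \<omega> \<in> critical_set K F}"

definition pcf_boundary :: "'a set \<Rightarrow> ('i \<Rightarrow> 'a \<Rightarrow> 'a) \<Rightarrow> 'a set" where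
  "pcf_boundary K F = coding K F ` post_critical_set K F"

text \<open>Connectedness is part of the definition, as always when one does analysis on p.c.f.
  fractals: without it functions of energy zero need not be constant.\<close>

definition pcf_self_similar :: "'a::euclidean_space set \<Rightarrow> ('i::finite \<Rightarrow> 'a \<Rightarrow> 'a) \<Rightarrow> bool" where
  "pcf_self_similar K F \<longleftrightarrow>
     compact K \<and> connected K \<and> K \<noteq> {} \<and>
     (\<forall>i. contractive_similarity (F i)) \<and> K = (\<Union>i. F i ` K) \<and>
     finite (post_critical_set K F)"

text \<open>Every point of \<open>K\<close> has an address, and the boundary \<open>V\<^sub>0\<close> has the property that
  distinct cells of level one meet only in the images of boundary points.\<close>

lemma coding_eqI:
  assumes pcf: "pcf_self_similar K F"
    and x: "\<And>m. x \<in> foldr F (map \<omega> [0..<m]) ` K"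
  shows "coding K F \<omega> = x"
proof -
  have "\<forall>i. \<exists>\<rho>. 0 < \<rho> \<and> \<rho> < 1 \<and> (\<forall>x y. dist (F i x) (F i y) = \<rho> * dist x y)"
    using pcf by (simp add: pcf_self_similar_def contractive_similarity_def)
  then obtain s where s: "\<And>i. 0 < s i" "\<And>i. s i < 1"
      "\<And>i x y. dist (F i x) (F i y) = s i * dist x y"
    by metis
  define \<rho> where "\<rho> = Max (range s)"
  have \<rho>: "s i \<le> \<rho>" for i unfolding \<rho>_def by (rule Max_ge) auto
  have "\<rho> \<in> range s" unfolding \<rho>_def by (rule Max_in) auto
  then have \<rho>01: "0 < \<rho>" "\<rho> < 1" using s by auto
  have lip: "dist (foldr F w a) (foldr F w b) \<le> \<rho> ^ length w * dist a b" for w a b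
  proof (induction w)
    case (Cons i w)
    have "dist (foldr F (i # w) a) (foldr F (i # w) b)
        = s i * dist (foldr F w a) (foldr F w b)" by (simp add: s)
    also have "\<dots> \<le> \<rho> * (\<rho> ^ length w * dist a b)"
      using Cons.IH \<rho> \<rho>01 by (intro mult_mono) auto
    finally show ?case by simp
  qed simp
  have bnd: "bounded K" using pcf by (simp add: pcf_self_similar_def compact_imp_bounded)
  show ?thesis unfolding coding_def
  proof (rule the_equality)
    show "\<forall>m. x \<in> foldr F (map \<omega> [0..<m]) ` K" using x by blast
  next
    fix y assume y: "\<forall>m. y \<in> foldr F (map \<omega> [0..<m]) ` K"
    have le: "dist y x \<le> \<rho> ^ m * diameter K" for m
    proof -
      obtain a b where ab: "a \<in> K" "b \<in> K"
          "y = foldr F (map \<omega> [0..<m]) a" "x = foldr F (map \<omega> [0..<m]) b"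
        using x[of m] y by blast
      have "dist y x \<le> \<rho> ^ m * dist a b" using lip[of "map \<omega> [0..<m]" a b] ab by simp
      also have "\<dots> \<le> \<rho> ^ m * diameter K"
        using diameter_bounded_bound[OF bnd ab(1,2)] \<rho>01 by (intro mult_left_mono) auto
      finally show ?thesis .
    qed
    have "(\<lambda>m. \<rho> ^ m * diameter K) \<longlonglongrightarrow> 0 * diameter K"
      using \<rho>01 by (intro tendsto_mult LIMSEQ_power_zero tendsto_const) auto
    then have "dist y x \<le> 0 * diameter K"
      by (rule LIMSEQ_le_const) (use le in blast)
    then show "y = x" by simp
  qed
qed

lemma address_exists:
  assumes K: "K = (\<Union>i. F i ` K)" and "x \<in> K"
  shows "\<exists>\<omega>. \<forall>m. x \<in> foldr F (map \<omega> [0..<m]) ` K"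
proof -
  have "\<forall>y\<in>K. \<exists>i z. z \<in> K \<and> y = F i z" using K by blast
  then obtain I Z where IZ: "\<And>y. y \<in> K \<Longrightarrow> Z y \<in> K \<and> y = F (I y) (Z y)" by metis
  define \<omega> where "\<omega> k = I ((Z ^^ k) x)" for k
  have "(Z ^^ m) x \<in> K \<and> x = foldr F (map \<omega> [0..<m]) ((Z ^^ m) x)" for m
  proof (induction m)
    case (Suc m)
    then show ?case using IZ[of "(Z ^^ m) x"] by (simp add: \<omega>_def)
  qed (use assms in simp)
  then show ?thesis by blast
qed

lemma cells_meet_in_boundary:
  assumes pcf: "pcf_self_similar K F" and "i \<noteq> j"
  shows "F i ` K \<inter> F j ` K \<subseteq> F i ` pcf_boundary K F \<inter> F j ` pcf_boundary K F"
proof -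
  have K: "K = (\<Union>i. F i ` K)" using pcf by (simp add: pcf_self_similar_def)
  have *: "F i p \<in> F i ` pcf_boundary K F"
    if "p \<in> K" "F i p \<in> F j ` K" "i \<noteq> j" for i j p
  proof -
    obtain \<omega> where \<omega>: "\<And>m. p \<in> foldr F (map \<omega> [0..<m]) ` K"
      using address_exists[OF K \<open>p \<in> K\<close>] by blast
    define \<tau> where "\<tau> = case_nat i \<omega>"
    have "F i p \<in> foldr F (map \<tau> [0..<m]) ` K" for m
    proof (cases m)
      case 0 then show ?thesis using K \<open>p \<in> K\<close> by auto
    next
      case (Suc n)
      have "map \<tau> [0..<m] = i # map \<omega> [0..<n]"
        unfolding Suc map_upt_Suc by (simp add: \<tau>_def)
      then show ?thesis using \<omega>[of n] by auto
    qed
    then have "coding K F \<tau> = F i p" by (rule coding_eqI[OF pcf])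
    then have "\<tau> \<in> critical_set K F" using that by (auto simp: critical_set_def)
    moreover have "\<omega> = (\<lambda>k. \<tau> (k + 1))" by (simp add: \<tau>_def)
    ultimately have "\<omega> \<in> post_critical_set K F"
      unfolding post_critical_set_def by blast
    moreover have "coding K F \<omega> = p" using \<omega> by (rule coding_eqI[OF pcf])
    ultimately show ?thesis unfolding pcf_boundary_def by blast
  qed
  show ?thesis
  proof
    fix x assume x: "x \<in> F i ` K \<inter> F j ` K"
    then obtain p q where "p \<in> K" "x = F i p" "q \<in> K" "x = F j q" by blast
    then show "x \<in> F i ` pcf_boundary K F \<inter> F j ` pcf_boundary K F"
      using *[of p i j] *[of q j i] x \<open>i \<noteq> j\<close> by auto
  qed
qed


section \<open>Regular harmonic structures and their energy\<close>

text \<open>Functions on \<open>K\<close> are functions on the ambient space of which only the values on \<open>K\<close>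
  matter.  A Laplacian on \<open>V\<^sub>0\<close> is given by its off-diagonal entries \<open>c x y\<close> (conductances).\<close>

definition boundary_energy ::
    "'a set \<Rightarrow> ('i \<Rightarrow> 'a \<Rightarrow> 'a) \<Rightarrow> ('a \<Rightarrow> 'a \<Rightarrow> real) \<Rightarrow> ('a \<Rightarrow> real) \<Rightarrow> ('a \<Rightarrow> real) \<Rightarrow> real" where
  "boundary_energy K F c u v =
     (\<Sum>x\<in>pcf_boundary K F. \<Sum>y\<in>pcf_boundary K F. c x y * (u x - u y) * (v x - v y)) / 2"

definition level_energy ::
    "'a set \<Rightarrow> ('i::finite \<Rightarrow> 'a \<Rightarrow> 'a) \<Rightarrow> ('i \<Rightarrow> real) \<Rightarrow> ('a \<Rightarrow> 'a \<Rightarrow> real) \<Rightarrow> nat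
      \<Rightarrow> ('a \<Rightarrow> real) \<Rightarrow> ('a \<Rightarrow> real) \<Rightarrow> real" where
  "level_energy K F r c m u v =
     (\<Sum>w | length w = m.
        inverse (prod_list (map r w)) * boundary_energy K F c (u \<circ> foldr F w) (v \<circ> foldr F w))"

text \<open>The last clause is Kigami's compatibility condition: the energy of \<open>u\<close> on \<open>V\<^sub>0\<close> is the
  minimum of the level-one energies of the extensions of \<open>u\<close> to \<open>V\<^sub>1\<close>.\<close>

definition regular_harmonic_structure ::
    "'a set \<Rightarrow> ('i::finite \<Rightarrow> 'a \<Rightarrow> 'a) \<Rightarrow> ('i \<Rightarrow> real) \<Rightarrow> ('a \<Rightarrow> 'a \<Rightarrow> real) \<Rightarrow> bool" where
  "regular_harmonic_structure K F r c \<longleftrightarrow>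
     (\<forall>i. 0 < r i \<and> r i < 1) \<and>
     (\<forall>x\<in>pcf_boundary K F. \<forall>y\<in>pcf_boundary K F. c x y = c y x \<and> 0 \<le> c x y) \<and>
     (\<forall>u. boundary_energy K F c u u = 0 \<longrightarrow> (\<exists>a. \<forall>x\<in>pcf_boundary K F. u x = a)) \<and>
     (\<forall>u. (\<exists>v. (\<forall>x\<in>pcf_boundary K F. v x = u x) \<and>
               level_energy K F r c 1 v v = boundary_energy K F c u u) \<and>
          (\<forall>v. (\<forall>x\<in>pcf_boundary K F. v x = u x) \<longrightarrow>
               boundary_energy K F c u u \<le> level_energy K F r c 1 v v))"

text \<open>By compatibility \<open>level_energy K F r c m u u\<close> is nondecreasing in \<open>m\<close>, so convergence
  in \<open>dom_energy\<close> says exactly that the limit, the energy of \<open>u\<close>, is finite.\<close>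

definition energy ::
    "'a set \<Rightarrow> ('i::finite \<Rightarrow> 'a \<Rightarrow> 'a) \<Rightarrow> ('i \<Rightarrow> real) \<Rightarrow> ('a \<Rightarrow> 'a \<Rightarrow> real)
      \<Rightarrow> ('a \<Rightarrow> real) \<Rightarrow> ('a \<Rightarrow> real) \<Rightarrow> real" where
  "energy K F r c u v = lim (\<lambda>m. level_energy K F r c m u v)"

definition dom_energy ::
    "'a::topological_space set \<Rightarrow> ('i::finite \<Rightarrow> 'a \<Rightarrow> 'a) \<Rightarrow> ('i \<Rightarrow> real) \<Rightarrow> ('a \<Rightarrow> 'a \<Rightarrow> real)
      \<Rightarrow> ('a \<Rightarrow> real) set" where
  "dom_energy K F r c = {u. continuous_on K u \<and> convergent (\<lambda>m. level_energy K F r c m u u)}"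


section \<open>Measure and Laplacian\<close>

definition admissible_measure :: "'a::topological_space set \<Rightarrow> 'a measure \<Rightarrow> bool" where
  "admissible_measure K \<mu> \<longleftrightarrow>
     prob_space \<mu> \<and> sets \<mu> = sets (restrict_space borel K) \<and>
     (\<forall>x\<in>K. emeasure \<mu> {x} = 0) \<and>
     (\<forall>U. open U \<and> U \<inter> K \<noteq> {} \<longrightarrow> 0 < emeasure \<mu> (U \<inter> K))"

text \<open>If \<open>V\<^sub>0 \<subseteq> E\<close>, the weak equation is only tested against functions vanishing on \<open>V\<^sub>0\<close>;
  this makes the domain of the Laplacian as large as possible.\<close>

definition is_laplacian ::
    "'a::topological_space set \<Rightarrow> ('i::finite \<Rightarrow> 'a \<Rightarrow> 'a) \<Rightarrow> ('i \<Rightarrow> real) \<Rightarrow> ('a \<Rightarrow> 'a \<Rightarrow> real)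
      \<Rightarrow> 'a measure \<Rightarrow> 'a set \<Rightarrow> ('a \<Rightarrow> real) \<Rightarrow> ('a \<Rightarrow> real) \<Rightarrow> bool" where
  "is_laplacian K F r c \<mu> E u f \<longleftrightarrow>
     integrable \<mu> f \<and>
     (\<forall>v\<in>dom_energy K F r c.
        (pcf_boundary K F \<subseteq> E \<longrightarrow> (\<forall>x\<in>pcf_boundary K F. v x = 0)) \<longrightarrow>
        (\<integral>x. v x * f x \<partial>\<mu>) = - energy K F r c u v)"

definition dom_L1_laplacian ::
    "'a::topological_space set \<Rightarrow> ('i::finite \<Rightarrow> 'a \<Rightarrow> 'a) \<Rightarrow> ('i \<Rightarrow> real) \<Rightarrow> ('a \<Rightarrow> 'a \<Rightarrow> real)
      \<Rightarrow> 'a measure \<Rightarrow> 'a set \<Rightarrow> ('a \<Rightarrow> real) set" where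
  "dom_L1_laplacian K F r c \<mu> E =
     {u \<in> dom_energy K F r c. \<exists>f. is_laplacian K F r c \<mu> E u f}"

text \<open>Determined up to \<open>\<mu>\<close>-null sets.\<close>

definition laplacian ::
    "'a::topological_space set \<Rightarrow> ('i::finite \<Rightarrow> 'a \<Rightarrow> 'a) \<Rightarrow> ('i \<Rightarrow> real) \<Rightarrow> ('a \<Rightarrow> 'a \<Rightarrow> real)
      \<Rightarrow> 'a measure \<Rightarrow> 'a set \<Rightarrow> ('a \<Rightarrow> real) \<Rightarrow> 'a \<Rightarrow> real" where
  "laplacian K F r c \<mu> E u = (SOME f. is_laplacian K F r c \<mu> E u f)"


section \<open>Green's function\<close>

definition dirichlet_solution ::
    "'a::topological_space set \<Rightarrow> ('i::finite \<Rightarrow> 'a \<Rightarrow> 'a) \<Rightarrow> ('i \<Rightarrow> real) \<Rightarrow> ('a \<Rightarrow> 'a \<Rightarrow> real)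
      \<Rightarrow> 'a measure \<Rightarrow> 'a set \<Rightarrow> ('a \<Rightarrow> real) \<Rightarrow> ('a \<Rightarrow> real) \<Rightarrow> bool" where
  "dirichlet_solution K F r c \<mu> E f h \<longleftrightarrow>
     h \<in> dom_energy K F r c \<and> (\<forall>x\<in>E. h x = 0) \<and>
     (\<forall>v\<in>dom_energy K F r c. (\<forall>x\<in>E. v x = 0) \<longrightarrow>
        energy K F r c h v = (\<integral>x. f x * v x \<partial>\<mu>))"

text \<open>Continuity makes the Green's function unique on \<open>K \<times> K\<close>, since \<open>\<mu>\<close> charges every
  nonempty open set; \<open>green\<close> is unspecified off \<open>K \<times> K\<close>.\<close>

definition is_green ::
    "'a::topological_space set \<Rightarrow> ('i::finite \<Rightarrow> 'a \<Rightarrow> 'a) \<Rightarrow> ('i \<Rightarrow> real) \<Rightarrow> ('a \<Rightarrow> 'a \<Rightarrow> real)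
      \<Rightarrow> 'a measure \<Rightarrow> 'a set \<Rightarrow> ('a \<Rightarrow> 'a \<Rightarrow> real) \<Rightarrow> bool" where
  "is_green K F r c \<mu> E G \<longleftrightarrow>
     continuous_on (K \<times> K) (\<lambda>(x, y). G x y) \<and>
     (\<forall>x\<in>K. \<forall>y\<in>K. G x y = G y x) \<and>
     (\<forall>f. integrable \<mu> f \<longrightarrow>
        dirichlet_solution K F r c \<mu> E f (\<lambda>x. \<integral>y. G x y * f y \<partial>\<mu>))"

definition green ::
    "'a::topological_space set \<Rightarrow> ('i::finite \<Rightarrow> 'a \<Rightarrow> 'a) \<Rightarrow> ('i \<Rightarrow> real) \<Rightarrow> ('a \<Rightarrow> 'a \<Rightarrow> real)
      \<Rightarrow> 'a measure \<Rightarrow> 'a set \<Rightarrow> 'a \<Rightarrow> 'a \<Rightarrow> real" where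
  "green K F r c \<mu> E = (SOME G. is_green K F r c \<mu> E G)"

definition green_mean ::
    "'a::topological_space set \<Rightarrow> ('i::finite \<Rightarrow> 'a \<Rightarrow> 'a) \<Rightarrow> ('i \<Rightarrow> real) \<Rightarrow> ('a \<Rightarrow> 'a \<Rightarrow> real)
      \<Rightarrow> 'a measure \<Rightarrow> 'a set \<Rightarrow> 'a \<Rightarrow> real" where
  "green_mean K F r c \<mu> E x = (\<integral>y. green K F r c \<mu> E x y \<partial>\<mu>)"

definition \<delta>\<^sub>0 ::
    "'a::topological_space set \<Rightarrow> ('i::finite \<Rightarrow> 'a \<Rightarrow> 'a) \<Rightarrow> ('i \<Rightarrow> real) \<Rightarrow> ('a \<Rightarrow> 'a \<Rightarrow> real)
      \<Rightarrow> 'a measure \<Rightarrow> 'a set \<Rightarrow> real" where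
  "\<delta>\<^sub>0 K F r c \<mu> E = sqrt (\<integral>x. green_mean K F r c \<mu> E x \<partial>\<mu>)"

definition \<delta>\<^sub>1 ::
    "'a::topological_space set \<Rightarrow> ('i::finite \<Rightarrow> 'a \<Rightarrow> 'a) \<Rightarrow> ('i \<Rightarrow> real) \<Rightarrow> ('a \<Rightarrow> 'a \<Rightarrow> real)
      \<Rightarrow> 'a measure \<Rightarrow> 'a set \<Rightarrow> real" where
  "\<delta>\<^sub>1 K F r c \<mu> E = (SUP x\<in>K. green_mean K F r c \<mu> E x)"


section \<open>Piecewise harmonic splines and quadrature weights\<close>

definition splines ::
    "'a::topological_space set \<Rightarrow> ('i::finite \<Rightarrow> 'a \<Rightarrow> 'a) \<Rightarrow> ('i \<Rightarrow> real) \<Rightarrow> ('a \<Rightarrow> 'a \<Rightarrow> real)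
      \<Rightarrow> 'a set \<Rightarrow> ('a \<Rightarrow> real) set" where
  "splines K F r c E =
     {v \<in> dom_energy K F r c. \<forall>\<phi>\<in>dom_energy K F r c.
        (\<forall>x\<in>E. \<phi> x = 0) \<longrightarrow> energy K F r c v \<phi> = 0}"

text \<open>Unique as a function on \<open>K\<close>.\<close>

definition spline_basis ::
    "'a::topological_space set \<Rightarrow> ('i::finite \<Rightarrow> 'a \<Rightarrow> 'a) \<Rightarrow> ('i \<Rightarrow> real) \<Rightarrow> ('a \<Rightarrow> 'a \<Rightarrow> real)
      \<Rightarrow> 'a set \<Rightarrow> 'a \<Rightarrow> 'a \<Rightarrow> real" where
  "spline_basis K F r c E x =
     (SOME v. v \<in> splines K F r c E \<and> v x = 1 \<and> (\<forall>y\<in>E - {x}. v y = 0))"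

definition spline_weight ::
    "'a::topological_space set \<Rightarrow> ('i::finite \<Rightarrow> 'a \<Rightarrow> 'a) \<Rightarrow> ('i \<Rightarrow> real) \<Rightarrow> ('a \<Rightarrow> 'a \<Rightarrow> real)
      \<Rightarrow> 'a measure \<Rightarrow> 'a set \<Rightarrow> 'a \<Rightarrow> real" where
  "spline_weight K F r c \<mu> E x = (\<integral>y. spline_basis K F r c E x y \<partial>\<mu>)"

end

theory Submission
  imports Defs
begin

text \<open>
  Write \<open>g\<close> for the function \<open>g\<^sub>E\<close>, that is, for the solution of \<open>-\<Delta> g = 1\<close>, \<open>g = 0\<close> on \<open>E\<close>,
  and let \<open>s\<close> be the spline that agrees with \<open>u\<close> on \<open>E\<close>.  The quadrature rule integrates \<open>s\<close>
  exactly, so its error on \<open>u\<close> is the integral of \<open>u - s\<close>, and this function vanishes on \<open>E\<close>.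
  Testing the equation of \<open>g\<close> against it gives \<open>\<E>(g, u - s)\<close>; here \<open>\<E>(g, s) = 0\<close>, because \<open>s\<close>
  is a spline and \<open>g\<close> vanishes on \<open>E\<close>.  The error is therefore exactly \<open>\<E>(g, u)\<close>
  (\<open>quadrature_error\<close>), and both estimates read off this number.  By Cauchy-Schwarz it is at
  most \<open>\<E>(g)\<^bsup>1/2\<^esup> \<E>(u)\<^bsup>1/2\<^esup>\<close>, and \<open>\<E>(g) = \<integral> g d\<mu> = \<delta>\<^sub>0\<^sup>2\<close>.  By the definition of the Laplacian of
  \<open>u\<close> it is \<open>-\<integral> g \<Delta>u d\<mu>\<close>, and \<open>0 \<le> g \<le> \<delta>\<^sub>1\<close>.  The lower bound \<open>0 \<le> g\<close> is a Markov argument: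
  passing to \<open>\<bar>g\<bar>\<close> does not increase the energy, and \<open>g\<close> is the unique minimizer of
  \<open>\<E>(v) - 2 \<integral> v d\<mu>\<close> (\<open>green_mean_nonneg\<close>).

  The substance of the proof is that the objects in this argument exist: the Green's function
  and the basic splines are picked by a choice operator, which is of no use before something
  with the required property has been produced.

  All of them come from Riesz representation in the space \<open>dom\<^sub>0\<close> of the functions of finite
  energy that vanish on \<open>E\<close>.  That this space is complete and that point evaluations are bounded
  on it rests on one estimate, \<open>\<bar>u x - u y\<bar> \<le> C \<E>(u)\<^bsup>1/2\<^esup>\<close>.  It is easy to obtain on the finite
  set of the vertices of level one, from irreducibility of the conductances on \<open>V\<^sub>0\<close> and
  connectedness of \<open>K\<close>.  Self-similarity spreads it to the vertices of all levels: in a cell \<open>w\<close>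
  the rescaled function has at most \<open>r\<^sub>w\<close> times the energy, so that the increments
  from level to level form a geometric series.  The same scaling makes functions of bounded
  energy equicontinuous, and this gives the continuity of the Green's function
  \<open>G x y = \<E>(G x, G y)\<close>, where \<open>G x\<close> represents evaluation at \<open>x\<close>.

  Splines need in addition a function of finite energy with prescribed values on \<open>E\<close>.  The points
  of \<open>E\<close> need not be vertices, so one takes a level \<open>m\<close> at which no cell containing another
  point of \<open>E\<close> meets a cell containing \<open>x\<close>, prescribes \<open>1\<close> on the vertices in the cells around \<open>x\<close> and
  \<open>0\<close> on the others, and extends harmonically.  The extension is constant on every cell on whose
  boundary it is constant.
\<close>

section \<open>Riesz representation for spaces of functions\<close>

text \<open>A positive semidefinite form is what is available: functions on the ambient space that agree
  on \<open>K\<close> have distance zero, and so no inner product type applies.\<close>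

locale form_space =
  fixes D :: "('b \<Rightarrow> real) set" and B :: "('b \<Rightarrow> real) \<Rightarrow> ('b \<Rightarrow> real) \<Rightarrow> real"
  assumes zero_mem: "(\<lambda>_. 0) \<in> D"
    and lin_mem: "u \<in> D \<Longrightarrow> v \<in> D \<Longrightarrow> (\<lambda>x. u x + a * v x) \<in> D"
    and commute: "u \<in> D \<Longrightarrow> v \<in> D \<Longrightarrow> B u v = B v u"
    and lin: "u \<in> D \<Longrightarrow> v \<in> D \<Longrightarrow> w \<in> D \<Longrightarrow> B (\<lambda>x. u x + a * v x) w = B u w + a * B v w"
    and nonneg: "u \<in> D \<Longrightarrow> 0 \<le> B u u"
begin

lemma diff_mem: "u \<in> D \<Longrightarrow> v \<in> D \<Longrightarrow> (\<lambda>x. u x - v x) \<in> D"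
  using lin_mem[of u v "-1"] by simp

lemma diff_left: "u \<in> D \<Longrightarrow> v \<in> D \<Longrightarrow> w \<in> D \<Longrightarrow> B (\<lambda>x. u x - v x) w = B u w - B v w"
  using lin[of u v w "-1"] by simp

lemma lin_right: "u \<in> D \<Longrightarrow> v \<in> D \<Longrightarrow> w \<in> D \<Longrightarrow> B w (\<lambda>x. u x + a * v x) = B w u + a * B w v"
  using lin[of u v w a] commute lin_mem by simp

lemma diff_right: "u \<in> D \<Longrightarrow> v \<in> D \<Longrightarrow> w \<in> D \<Longrightarrow> B w (\<lambda>x. u x - v x) = B w u - B w v"
  using lin_right[of u v w "-1"] by simp

lemma quad:
  assumes "u \<in> D" "v \<in> D"
  shows "B (\<lambda>x. u x + a * v x) (\<lambda>x. u x + a * v x) = B u u + 2 * a * B u v + a\<^sup>2 * B v v"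
  using assms commute[of u v] by (simp add: lin lin_right lin_mem power2_eq_square algebra_simps)

lemma quad_diff:
  assumes "u \<in> D" "v \<in> D"
  shows "B (\<lambda>x. u x - v x) (\<lambda>x. u x - v x) = B u u - 2 * B u v + B v v"
  using quad[OF assms, of "-1"] by simp

lemma zero_left: "u \<in> D \<Longrightarrow> B (\<lambda>_. 0) u = 0"
  using lin[OF zero_mem zero_mem, of u 1] by simp

lemma cauchy_schwarz:
  assumes u: "u \<in> D" and v: "v \<in> D"
  shows "\<bar>B u v\<bar> \<le> sqrt (B u u) * sqrt (B v v)"
proof -
  have pos: "0 \<le> B u u + 2 * a * B u v + a\<^sup>2 * B v v" for a
    using nonneg[OF lin_mem[OF u v, of a]] quad[OF u v, of a] by simp
  have "(B u v)\<^sup>2 \<le> B u u * B v v"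
  proof (cases "B v v = 0")
    case True
    have "B u v = 0"
    proof (rule ccontr)
      assume "B u v \<noteq> 0"
      with pos[of "- (B u u + 1) / (2 * B u v)"] True show False
        by (simp add: field_simps)
    qed
    then show ?thesis using True by simp
  next
    case False
    with nonneg[OF v] have p: "B v v > 0" by simp
    have "0 \<le> (B u u + 2 * (- B u v / B v v) * B u v + (- B u v / B v v)\<^sup>2 * B v v) * B v v"
      using pos[of "- B u v / B v v"] p by (intro mult_nonneg_nonneg) auto
    also have "\<dots> = B u u * B v v - (B u v)\<^sup>2"
      using p by (simp add: power2_eq_square field_simps)
    finally show ?thesis by simp
  qed
  then have "sqrt ((B u v)\<^sup>2) \<le> sqrt (B u u * B v v)" by (rule real_sqrt_le_mono)
  then show ?thesis by (simp add: real_sqrt_mult)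
qed

text \<open>The representing element is a minimizer of \<open>J v = B v v - 2 * l v\<close>.  By the parallelogram
  identity a minimizing sequence is Cauchy, and the limit satisfies the variational equation since
  \<open>J\<close> cannot decrease along any line through it.\<close>

lemma riesz:
  assumes complete: "\<And>s. (\<And>n. s n \<in> D) \<Longrightarrow>
       (\<And>e. e > 0 \<Longrightarrow> \<exists>N. \<forall>m\<ge>N. \<forall>n\<ge>N. B (\<lambda>x. s m x - s n x) (\<lambda>x. s m x - s n x) \<le> e) \<Longrightarrow>
       \<exists>u\<in>D. (\<lambda>n. B (\<lambda>x. s n x - u x) (\<lambda>x. s n x - u x)) \<longlonglongrightarrow> 0"
    and l_lin: "\<And>u v a. u \<in> D \<Longrightarrow> v \<in> D \<Longrightarrow> l (\<lambda>x. u x + a * v x) = l u + a * l v"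
    and l_bound: "\<And>v. v \<in> D \<Longrightarrow> \<bar>l v\<bar> \<le> C * sqrt (B v v)"
  shows "\<exists>h\<in>D. \<forall>v\<in>D. B h v = l v"
proof -
  define J where "J v = B v v - 2 * l v" for v
  have J_ge: "- C\<^sup>2 \<le> J v" if "v \<in> D" for v
  proof -
    have "(sqrt (B v v))\<^sup>2 = B v v" using nonneg[OF that] by simp
    moreover have "0 \<le> (sqrt (B v v) - C)\<^sup>2" by simp
    ultimately show ?thesis
      using l_bound[OF that] by (simp add: J_def power2_diff mult.commute)
  qed
  define I where "I = Inf (J ` D)"
  have bdd: "bdd_below (J ` D)" using J_ge by (meson bdd_belowI2)
  have I_le: "I \<le> J v" if "v \<in> D" for v
    unfolding I_def using bdd that by (rule cINF_lower)
  have "\<exists>v\<in>D. J v < I + 1 / (real n + 1)" for n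
    using cInf_lessD[of "J ` D" "I + 1 / (real n + 1)"] zero_mem unfolding I_def by auto
  then obtain s where s: "\<And>n. s n \<in> D" "\<And>n. J (s n) < I + 1 / (real n + 1)" by metis
  have J_lin: "J (\<lambda>x. u x + a * v x) = J u + 2 * a * (B u v - l v) + a\<^sup>2 * B v v"
    if "u \<in> D" "v \<in> D" for u v a
    using quad[OF that] l_lin[OF that] by (simp add: J_def algebra_simps)
  have l_diff: "l (\<lambda>x. u x - v x) = l u - l v" if "u \<in> D" "v \<in> D" for u v
    using l_lin[OF that, of "-1"] by simp
  have dist_le: "B (\<lambda>x. s m x - s n x) (\<lambda>x. s m x - s n x) \<le> 2 / (real m + 1) + 2 / (real n + 1)"
    for m n
  proof -
    let ?d = "\<lambda>x. s m x - s n x"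
    have d: "?d \<in> D" using diff_mem s by simp
    \<comment> \<open>The midpoint of \<open>s m\<close> and \<open>s n\<close> is a competitor; this is the parallelogram identity.\<close>
    have "I \<le> J (\<lambda>x. s n x + (1/2) * ?d x)" by (intro I_le lin_mem s d)
    also have "\<dots> = J (s n) + (B (s n) ?d - l ?d) + B ?d ?d / 4"
      by (subst J_lin) (simp_all add: s d power2_eq_square)
    also have "B (s n) ?d - l ?d = (J (s m) - J (s n) - B ?d ?d) / 2"
      using s d by (simp add: J_def l_diff quad_diff diff_right commute[of "s m" "s n"])
    finally have "B ?d ?d \<le> 2 * (J (s m) - I) + 2 * (J (s n) - I)"
      by (simp add: field_simps)
    then show ?thesis using s(2)[of m] s(2)[of n] by simp
  qed
  have "\<exists>u\<in>D. (\<lambda>n. B (\<lambda>x. s n x - u x) (\<lambda>x. s n x - u x)) \<longlonglongrightarrow> 0"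
  proof (rule complete)
    fix e :: real assume "e > 0"
    then obtain N where N: "4 / e < real N" using reals_Archimedean2 by blast
    have *: "2 / (real m + 1) \<le> e / 2" if "m \<ge> N" for m
    proof -
      have "4 / e \<le> real m + 1" using N that by linarith
      then show ?thesis using \<open>e > 0\<close> by (simp add: field_simps)
    qed
    show "\<exists>N. \<forall>m\<ge>N. \<forall>n\<ge>N. B (\<lambda>x. s m x - s n x) (\<lambda>x. s m x - s n x) \<le> e"
      using * dist_le by (intro exI[of _ N]) (smt (verit) field_sum_of_halves)
  qed (rule s)
  then obtain h where h: "h \<in> D" "(\<lambda>n. B (\<lambda>x. s n x - h x) (\<lambda>x. s n x - h x)) \<longlonglongrightarrow> 0" by blast
  have "B h v = l v" if v: "v \<in> D" for v
  proof -
    have lim: "(\<lambda>n. B (s n) v) \<longlonglongrightarrow> B h v"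
    proof -
      have "(\<lambda>n. sqrt (B (\<lambda>x. s n x - h x) (\<lambda>x. s n x - h x)) * sqrt (B v v)) \<longlonglongrightarrow> sqrt 0 * sqrt (B v v)"
        by (intro tendsto_intros h)
      then have "(\<lambda>n. B (\<lambda>x. s n x - h x) v) \<longlonglongrightarrow> 0"
        using cauchy_schwarz[OF diff_mem[OF s(1) h(1)] v]
        by (intro Lim_null_comparison[of "\<lambda>n. B (\<lambda>x. s n x - h x) v"]) (auto intro!: eventuallyI)
      then show ?thesis using s h v by (simp add: diff_left LIM_zero_iff)
    qed
    have pos: "0 \<le> 2 * a * (B h v - l v) + a\<^sup>2 * B v v" for a
    proof -
      have "(\<lambda>n. 2 * a * (B (s n) v - l v) + a\<^sup>2 * B v v + 1 / (real n + 1))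
              \<longlonglongrightarrow> 2 * a * (B h v - l v) + a\<^sup>2 * B v v + 0"
        using LIMSEQ_inverse_real_of_nat
        by (intro tendsto_intros lim) (simp add: inverse_eq_divide add.commute)
      moreover have "0 \<le> 2 * a * (B (s n) v - l v) + a\<^sup>2 * B v v + 1 / (real n + 1)" for n
        using I_le[OF lin_mem[OF s(1)[of n] v, of a]] s(2)[of n] J_lin[OF s(1)[of n] v, of a] by simp
      ultimately show ?thesis by (intro LIMSEQ_le_const) auto
    qed
    define d where "d = B h v - l v"
    show ?thesis
    proof (rule ccontr)
      assume "B h v \<noteq> l v"
      then have d: "d \<noteq> 0" by (simp add: d_def)
      define b where "b = B v v + 1"
      have b: "b > 0" "B v v \<le> b" using nonneg[OF v] by (auto simp: b_def)
      \<comment> \<open>Nearly the minimizer of the quadratic; the summand \<open>1\<close> in \<open>b\<close> covers the case \<open>B v v = 0\<close>.\<close>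
      have "0 \<le> 2 * (- d / b) * d + (- d / b)\<^sup>2 * B v v" using pos[of "- d / b"] by (simp add: d_def)
      also have "\<dots> \<le> 2 * (- d / b) * d + (- d / b)\<^sup>2 * b"
        using b by (intro add_left_mono mult_left_mono) auto
      also have "\<dots> = - (d\<^sup>2 / b)" using b by (simp add: power2_eq_square field_simps)
      finally have "d\<^sup>2 / b \<le> 0" by simp
      moreover have "0 < d\<^sup>2 / b" using b d by simp
      ultimately show False by simp
    qed
  qed
  with h show ?thesis by blast
qed

end

section \<open>Cells and vertices of a p.c.f. set\<close>

locale pcf_set =
  fixes K :: "'a::euclidean_space set" and F :: "'i::finite \<Rightarrow> 'a \<Rightarrow> 'a"
  assumes pcf: "pcf_self_similar K F"
begin

abbreviation V\<^sub>0 :: "'a set" where "V\<^sub>0 \<equiv> pcf_boundary K F"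

definition vertices :: "nat \<Rightarrow> 'a set" where
  "vertices m = (\<Union>w\<in>{w. length w = m}. foldr F w ` V\<^sub>0)"

definition all_vertices :: "'a set" where
  "all_vertices = (\<Union>m. vertices m)"

lemma K_eq: "K = (\<Union>i. F i ` K)" and compact_K: "compact K" and K_ne: "K \<noteq> {}"
  and connected_K: "connected K"
  using pcf by (simp_all add: pcf_self_similar_def)

lemma similarity_F: "\<exists>\<rho>. 0 < \<rho> \<and> \<rho> < 1 \<and> (\<forall>x y. dist (F i x) (F i y) = \<rho> * dist x y)"
  using pcf by (simp add: pcf_self_similar_def contractive_similarity_def)

lemma contraction:
  obtains s where "0 < s" "s < 1"
    "\<And>w x y. dist (foldr F w x) (foldr F w y) \<le> s ^ length w * dist x y"
proof -
  obtain \<rho> where \<rho>: "\<And>i. 0 < \<rho> i" "\<And>i. \<rho> i < 1"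
      "\<And>i x y. dist (F i x) (F i y) = \<rho> i * dist x y"
    using similarity_F by metis
  define s where "s = Max (range \<rho>)"
  have le: "\<rho> i \<le> s" for i unfolding s_def by (rule Max_ge) auto
  have "s \<in> range \<rho>" unfolding s_def by (rule Max_in) auto
  then have s: "0 < s" "s < 1" using \<rho> by auto
  have "dist (foldr F w x) (foldr F w y) \<le> s ^ length w * dist x y" for w x y
  proof (induction w)
    case (Cons i w)
    have "\<rho> i * dist (foldr F w x) (foldr F w y) \<le> s * (s ^ length w * dist x y)"
      using Cons.IH le s by (intro mult_mono) auto
    then show ?case by (simp add: \<rho>(3))
  qed simp
  with s that show thesis by blast
qed

lemma F_inj: "F i x = F i y \<longleftrightarrow> x = y"
proof -
  obtain \<rho> where "0 < \<rho>" "\<forall>x y. dist (F i x) (F i y) = \<rho> * dist x y"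
    using similarity_F by blast
  then show ?thesis by (metis dist_eq_0_iff less_irrefl mult_eq_0_iff)
qed

lemma word_inj: "foldr F w x = foldr F w y \<longleftrightarrow> x = y"
  by (induction w) (simp_all add: F_inj)

lemma continuous_word: "continuous_on A (foldr F w)"
proof -
  obtain s where s: "0 < s" "s < 1"
      "\<And>w x y. dist (foldr F w x) (foldr F w y) \<le> s ^ length w * dist x y"
    using contraction by blast
  have "dist (foldr F w x) (foldr F w y) \<le> dist x y" for x y
  proof -
    have "s ^ length w * dist x y \<le> 1 * dist x y"
      using s by (intro mult_right_mono power_le_one) auto
    then show ?thesis using s(3)[of w x y] by simp
  qed
  then show ?thesis
    unfolding continuous_on_iff by (meson order_le_less_trans)
qed

lemma F_mem: "x \<in> K \<Longrightarrow> F i x \<in> K"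
  using K_eq by blast

lemma word_mem: "x \<in> K \<Longrightarrow> foldr F w x \<in> K"
  by (induction w) (auto intro: F_mem)

lemma word_cover:
  assumes "x \<in> K"
  obtains w a where "length w = m" "a \<in> K" "x = foldr F w a"
proof -
  obtain \<omega> where "x \<in> foldr F (map \<omega> [0..<m]) ` K"
    using address_exists[OF K_eq assms] by blast
  then show thesis using that[of "map \<omega> [0..<m]"] by auto
qed

lemma compact_cell: "compact (foldr F w ` K)"
  by (intro compact_continuous_image continuous_word compact_K)

text \<open>The cells along an infinite word are nested nonempty compact sets, so the description in the
  definition of \<open>coding\<close> does define a point.\<close>

lemma coding_mem: "coding K F \<omega> \<in> foldr F (map \<omega> [0..<m]) ` K"
proof -
  let ?C = "\<lambda>m. foldr F (map \<omega> [0..<m]) ` K"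
  have step: "?C (Suc m) \<subseteq> ?C m" for m
    by (auto intro: F_mem)
  have "\<Inter>(range ?C) \<noteq> {}"
  proof (rule compact_nest)
    show "?C n \<subseteq> ?C m" if "m \<le> n" for m n
      using that by (rule lift_Suc_antimono_le[of ?C, OF step])
  qed (use compact_cell K_ne in auto)
  then obtain x where x: "\<And>m. x \<in> ?C m" by blast
  then show ?thesis using coding_eqI[OF pcf x] by simp
qed

lemma coding_in_K: "coding K F \<omega> \<in> K"
  using coding_mem[of \<omega> 0] by simp

lemma coding_case_nat: "coding K F (case_nat i \<omega>) = F i (coding K F \<omega>)"
proof (rule coding_eqI[OF pcf])
  fix m
  show "F i (coding K F \<omega>) \<in> foldr F (map (case_nat i \<omega>) [0..<m]) ` K"
  proof (cases m)
    case 0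
    then show ?thesis using F_mem[OF coding_in_K] by simp
  next
    case (Suc n)
    have "map (case_nat i \<omega>) [0..<m] = i # map \<omega> [0..<n]"
      unfolding Suc map_upt_Suc by simp
    then show ?thesis using coding_mem[of \<omega> n] by auto
  qed
qed

lemma coding_prepend: "coding K F (foldr case_nat w \<omega>) = foldr F w (coding K F \<omega>)"
  by (induction w) (simp_all add: coding_case_nat)

lemma shift_prepend: "(\<lambda>k. foldr case_nat w \<omega> (k + length w)) = \<omega>"
  by (induction w) simp_all

lemma address:
  assumes "x \<in> K"
  obtains \<omega> where "coding K F \<omega> = x"
  using address_exists[OF K_eq assms] coding_eqI[OF pcf] by blast

lemma boundary_subset: "V\<^sub>0 \<subseteq> K"
  unfolding pcf_boundary_def using coding_in_K by auto

lemma finite_boundary: "finite V\<^sub>0"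
  using pcf by (simp add: pcf_boundary_def pcf_self_similar_def)

text \<open>The shift of a post-critical word is post-critical.  Hence \<open>V\<^sub>0\<close> is contained in its
  images under the maps, and the vertex sets increase with the level.\<close>

lemma boundary_refine:
  assumes "p \<in> V\<^sub>0"
  obtains i q where "q \<in> V\<^sub>0" "p = F i q"
proof -
  obtain \<omega> where \<omega>: "\<omega> \<in> post_critical_set K F" "p = coding K F \<omega>"
    using assms by (auto simp: pcf_boundary_def)
  then obtain \<kappa> n where \<kappa>: "\<omega> = (\<lambda>k. \<kappa> (k + n))" "n \<ge> 1" "\<kappa> \<in> critical_set K F"
    by (auto simp: post_critical_set_def)
  let ?\<tau> = "\<lambda>k. \<kappa> (k + Suc n)"
  have "?\<tau> \<in> post_critical_set K F"
    unfolding post_critical_set_def using \<kappa> by (auto intro!: exI[of _ \<kappa>] exI[of _ "Suc n"])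
  moreover have "\<omega> = case_nat (\<omega> 0) ?\<tau>"
    by (rule ext) (simp add: \<kappa>(1) split: nat.split)
  then have "p = F (\<omega> 0) (coding K F ?\<tau>)"
    using \<omega>(2) coding_case_nat by metis
  ultimately show thesis using that by (auto simp: pcf_boundary_def)
qed

text \<open>Any address \<open>\<omega>\<close> of \<open>a\<close> extends to the address \<open>i # t\<close> followed by \<open>\<omega>\<close> of a point in two cells
  of level one.  The latter is critical, and \<open>\<omega>\<close> is one of its shifts.\<close>

lemma overlap_in_boundary:
  assumes "i \<noteq> j" "a \<in> K" "F i (foldr F t a) \<in> F j ` K"
  shows "a \<in> V\<^sub>0"
proof -
  obtain \<omega> where \<omega>: "coding K F \<omega> = a" using address[OF \<open>a \<in> K\<close>] .
  let ?\<tau> = "foldr case_nat (i # t) \<omega>"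
  have "coding K F ?\<tau> = F i (foldr F t a)"
    by (simp only: coding_prepend \<omega>) simp
  then have "?\<tau> \<in> critical_set K F"
    using assms word_mem[OF \<open>a \<in> K\<close>, of t] unfolding critical_set_def by auto
  moreover have "length (i # t) \<ge> 1" by simp
  ultimately have "(\<lambda>k. ?\<tau> (k + length (i # t))) \<in> post_critical_set K F"
    unfolding post_critical_set_def by blast
  then have "\<omega> \<in> post_critical_set K F" by (simp only: shift_prepend)
  then show ?thesis using \<omega> by (auto simp: pcf_boundary_def)
qed

text \<open>Cells of any common level meet only in images of boundary points: strip the common prefix of
  the two words, and what remains starts in different cells of level one.\<close>

lemma words_meet_in_boundary:
  assumes "length w = length w'" "w \<noteq> w'" "a \<in> K" "b \<in> K" "foldr F w a = foldr F w' b"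
  shows "a \<in> V\<^sub>0"
  using assms
proof (induction w w' rule: list_induct2)
  case (Cons i t j t')
  show ?case
  proof (cases "i = j")
    case True
    with Cons show ?thesis by (simp add: F_inj)
  next
    case False
    then show ?thesis
      using overlap_in_boundary[of i j a t] Cons.prems word_mem[of b t'] by auto
  qed
qed simp

text \<open>An induction principle for the cells of level one: since \<open>K\<close> is connected, its cover by these
  finitely many closed sets cannot be split into two disjoint parts.\<close>

lemma cells_chain:
  assumes "S \<noteq> {}" and step: "\<And>i j. i \<in> S \<Longrightarrow> F i ` K \<inter> F j ` K \<noteq> {} \<Longrightarrow> j \<in> S"
  shows "S = UNIV"
proof (rule ccontr)
  assume "S \<noteq> UNIV"
  have cl: "closed (\<Union>i\<in>T. F i ` K)" for T
    using compact_cell[of "[_]"] by (intro closed_UN) (auto simp: compact_imp_closed)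
  let ?A = "\<Union>i\<in>S. F i ` K" and ?B = "\<Union>i\<in>-S. F i ` K"
  have "?A \<inter> ?B \<inter> K = {}" using step by blast
  moreover have "(\<Union>i. F i ` K) \<subseteq> ?A \<union> ?B" by blast
  then have "K \<subseteq> ?A \<union> ?B" using equalityD1[OF K_eq] by (rule order_trans[rotated])
  moreover have "?A \<inter> K \<noteq> {}" "?B \<inter> K \<noteq> {}"
  proof -
    obtain i j x where "i \<in> S" "j \<notin> S" "x \<in> K"
      using \<open>S \<noteq> {}\<close> \<open>S \<noteq> UNIV\<close> K_ne by blast
    then show "?A \<inter> K \<noteq> {}" "?B \<inter> K \<noteq> {}" using F_mem by blast+
  qed
  ultimately show False
    using connected_closedD[OF connected_K _ _ cl[of S] cl[of "-S"]] by simp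
qed

text \<open>Without a boundary the cells of level one would be disjoint.  As \<open>K\<close> is connected there
  would be only one of them, hence only one infinite word and only one point.\<close>

lemma boundary_nonempty:
  assumes "\<And>x. K \<noteq> {x}"
  shows "V\<^sub>0 \<noteq> {}"
proof
  assume empty: "V\<^sub>0 = {}"
  have eq: "j = i" for i j :: 'i
  proof -
    have "{i} = UNIV"
      using cells_meet_in_boundary[OF pcf] empty by (intro cells_chain) blast+
    then show ?thesis by blast
  qed
  have "\<omega> = \<tau>" for \<omega> \<tau> :: "nat \<Rightarrow> 'i" using eq by blast
  then have "x = y" if "x \<in> K" "y \<in> K" for x y
    using address[OF that(1)] address[OF that(2)] by metis
  then show False using assms K_ne by blast
qed

lemma finite_words: "finite {w :: 'i list. length w = m}"
  using finite_lists_length_eq[of "UNIV :: 'i set" m] by simp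

lemma word_vertex: "length w = m \<Longrightarrow> p \<in> vertices n \<Longrightarrow> foldr F w p \<in> vertices (m + n)"
proof -
  assume "length w = m" "p \<in> vertices n"
  then obtain t q where "length t = n" "q \<in> V\<^sub>0" "p = foldr F t q"
    by (auto simp: vertices_def)
  then show "foldr F w p \<in> vertices (m + n)"
    using \<open>length w = m\<close> by (auto simp: vertices_def intro!: exI[of _ "w @ t"])
qed

lemma vertices_0: "vertices 0 = V\<^sub>0"
  by (simp add: vertices_def)

lemma vertices_Suc_subset: "vertices m \<subseteq> vertices (Suc m)"
proof
  fix x assume "x \<in> vertices m"
  then obtain w p where w: "length w = m" "p \<in> V\<^sub>0" "x = foldr F w p"
    by (auto simp: vertices_def)
  then obtain i q where "q \<in> V\<^sub>0" "p = F i q" using boundary_refine by blast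
  with w show "x \<in> vertices (Suc m)"
    by (auto simp: vertices_def intro!: exI[of _ "w @ [i]"])
qed

lemma vertices_mono: "m \<le> n \<Longrightarrow> vertices m \<subseteq> vertices n"
  by (rule lift_Suc_mono_le[of vertices, OF vertices_Suc_subset])

lemma vertices_split:
  assumes "x \<in> vertices (m + n)"
  obtains w y where "length w = m" "y \<in> vertices n" "x = foldr F w y"
proof -
  obtain w p where w: "length w = m + n" "p \<in> V\<^sub>0" "x = foldr F w p"
    using assms by (auto simp: vertices_def)
  have "x = foldr F (take m w) (foldr F (drop m w) p)"
    using w(3) by (metis append_take_drop_id foldr_append)
  moreover have "foldr F (drop m w) p \<in> vertices n"
    using w by (auto simp: vertices_def intro!: exI[of _ "drop m w"])
  ultimately show thesis using that[of "take m w"] w by simp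
qed

lemma boundary_all: "V\<^sub>0 \<subseteq> all_vertices"
  using vertices_0 by (auto simp: all_vertices_def)

lemma word_all: "p \<in> all_vertices \<Longrightarrow> foldr F w p \<in> all_vertices"
  using word_vertex[OF refl] by (auto simp: all_vertices_def)

lemma all_vertices_subset: "all_vertices \<subseteq> K"
  using boundary_subset word_mem by (auto simp: all_vertices_def vertices_def)

lemma all_vertices_split:
  assumes "x \<in> all_vertices"
  obtains w y where "length w = m" "y \<in> all_vertices" "x = foldr F w y"
proof -
  obtain n where "x \<in> vertices n" using assms by (auto simp: all_vertices_def)
  then have "x \<in> vertices (m + n)" using vertices_mono[of n "m + n"] by auto
  then show thesis using vertices_split that by (metis UN_I UNIV_I all_vertices_def)
qed

lemma dense_vertices:
  assumes "V\<^sub>0 \<noteq> {}"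
  shows "closure all_vertices = K"
proof
  show "closure all_vertices \<subseteq> K"
    using all_vertices_subset compact_K by (simp add: closure_minimal compact_imp_closed)
  show "K \<subseteq> closure all_vertices"
  proof
    fix x assume x: "x \<in> K"
    obtain p where p: "p \<in> V\<^sub>0" using assms by blast
    obtain s where s: "0 < s" "s < 1"
        "\<And>w x y. dist (foldr F w x) (foldr F w y) \<le> s ^ length w * dist x y"
      using contraction by blast
    show "x \<in> closure all_vertices"
      unfolding closure_approachable
    proof (intro allI impI)
      fix e :: real assume "e > 0"
      have "(\<lambda>m. s ^ m * diameter K) \<longlonglongrightarrow> 0 * diameter K"
        using s by (intro tendsto_mult LIMSEQ_power_zero tendsto_const) auto
      then have "\<forall>\<^sub>F m in sequentially. s ^ m * diameter K < e"
        by (rule order_tendstoD(2)) (use \<open>e > 0\<close> in simp)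
      then obtain m where m: "s ^ m * diameter K < e"
        by (auto simp: eventually_sequentially)
      obtain w a where w: "length w = m" "a \<in> K" "x = foldr F w a" using word_cover[OF x] .
      have "dist (foldr F w p) x \<le> s ^ m * dist p a" using s(3)[of w p a] w by simp
      also have "\<dots> \<le> s ^ m * diameter K"
        using diameter_bounded_bound[of K p a] compact_K p boundary_subset w s
        by (intro mult_left_mono) (auto simp: compact_imp_bounded)
      finally show "\<exists>y\<in>all_vertices. dist y x < e"
        using m word_all[of p w] p boundary_all by (intro bexI[of _ "foldr F w p"]) auto
    qed
  qed
qed

text \<open>Nearby points lie in the same cell or in cells that touch.  This turns bounds on the oscillation
  over cells into a modulus of continuity.\<close>

lemma cells_separated:
  obtains \<delta> where "0 < \<delta>"
    "\<And>w w' a b. length w = m \<Longrightarrow> length w' = m \<Longrightarrow> a \<in> foldr F w ` K \<Longrightarrow> b \<in> foldr F w' ` K \<Longrightarrow>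
       dist a b < \<delta> \<Longrightarrow> foldr F w ` K \<inter> foldr F w' ` K \<noteq> {}"
proof -
  let ?W = "{w :: 'i list. length w = m}"
  have "\<exists>d>0. foldr F (fst p) ` K \<inter> foldr F (snd p) ` K = {} \<longrightarrow>
          (\<forall>a\<in>foldr F (fst p) ` K. \<forall>b\<in>foldr F (snd p) ` K. d \<le> dist a b)" for p
    using separate_compact_closed[OF compact_cell compact_imp_closed[OF compact_cell]]
    by (meson zero_less_one)
  then obtain d where d: "\<And>p. d p > 0" "\<And>p. foldr F (fst p) ` K \<inter> foldr F (snd p) ` K = {} \<Longrightarrow>
          (\<forall>a\<in>foldr F (fst p) ` K. \<forall>b\<in>foldr F (snd p) ` K. d p \<le> dist a b)"
    by metis
  define \<delta> where "\<delta> = Min (insert 1 (d ` (?W \<times> ?W)))"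
  have fin: "finite (insert 1 (d ` (?W \<times> ?W)))" using finite_words by simp
  have "0 < \<delta>" unfolding \<delta>_def using fin d by (subst Min_gr_iff) auto
  have le: "\<delta> \<le> d (w, w')" if "length w = m" "length w' = m" for w w'
    unfolding \<delta>_def using that by (intro Min_le fin) auto
  show thesis
  proof (rule that[OF \<open>0 < \<delta>\<close>])
    fix w w' a b
    assume w: "length w = m" "length w' = m" and ab: "a \<in> foldr F w ` K" "b \<in> foldr F w' ` K"
      and "dist a b < \<delta>"
    show "foldr F w ` K \<inter> foldr F w' ` K \<noteq> {}"
    proof
      assume "foldr F w ` K \<inter> foldr F w' ` K = {}"
      then have "d (w, w') \<le> dist a b"
        using d(2)[of "(w, w')"] ab unfolding fst_conv snd_conv by blast
      then show False using le[OF w] \<open>dist a b < \<delta>\<close> by linarith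
    qed
  qed
qed

end

section \<open>Level energies and the oscillation of functions of bounded energy\<close>

locale harmonic_structure = pcf_set K F
  for K :: "'a::euclidean_space set" and F :: "'i::finite \<Rightarrow> 'a \<Rightarrow> 'a" +
  fixes r :: "'i \<Rightarrow> real" and c :: "'a \<Rightarrow> 'a \<Rightarrow> real"
  assumes harmonic: "regular_harmonic_structure K F r c"
    and V0_ne: "pcf_boundary K F \<noteq> {}"
begin

abbreviation \<E>\<^sub>0 :: "('a \<Rightarrow> real) \<Rightarrow> ('a \<Rightarrow> real) \<Rightarrow> real" where
  "\<E>\<^sub>0 \<equiv> boundary_energy K F c"

abbreviation level :: "nat \<Rightarrow> ('a \<Rightarrow> real) \<Rightarrow> ('a \<Rightarrow> real) \<Rightarrow> real" where
  "level \<equiv> level_energy K F r c"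

definition weight :: "'i list \<Rightarrow> real" where
  "weight w = prod_list (map r w)"

lemma r_pos: "0 < r i" and r_less_1: "r i < 1"
  using harmonic by (simp_all add: regular_harmonic_structure_def)

lemma c_sym: "x \<in> V\<^sub>0 \<Longrightarrow> y \<in> V\<^sub>0 \<Longrightarrow> c x y = c y x"
  and c_nonneg: "x \<in> V\<^sub>0 \<Longrightarrow> y \<in> V\<^sub>0 \<Longrightarrow> 0 \<le> c x y"
  using harmonic by (simp_all add: regular_harmonic_structure_def)

lemma weight_pos: "0 < weight w"
  by (induction w) (simp_all add: weight_def r_pos)

lemma weight_append: "weight (w @ t) = weight w * weight t"
  by (simp add: weight_def)

lemma level_eq:
  "level m u v = (\<Sum>w | length w = m. inverse (weight w) * \<E>\<^sub>0 (u \<circ> foldr F w) (v \<circ> foldr F w))"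
  by (simp add: level_energy_def weight_def)

lemma level_0: "level 0 = \<E>\<^sub>0"
  by (intro ext) (simp add: level_eq weight_def)

lemma boundary_energy_nonneg: "0 \<le> \<E>\<^sub>0 u u"
  unfolding boundary_energy_def
  by (intro divide_nonneg_nonneg sum_nonneg) (simp_all add: c_nonneg mult.assoc)

lemma boundary_energy_cong:
  "(\<And>x. x \<in> V\<^sub>0 \<Longrightarrow> u x = u' x) \<Longrightarrow> (\<And>x. x \<in> V\<^sub>0 \<Longrightarrow> v x = v' x) \<Longrightarrow> \<E>\<^sub>0 u v = \<E>\<^sub>0 u' v'"
  unfolding boundary_energy_def by simp

lemma boundary_energy_lin:
  "\<E>\<^sub>0 (\<lambda>x. u x + a * v x) w = \<E>\<^sub>0 u w + a * \<E>\<^sub>0 v w"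
proof -
  have "c x y * ((u x + a * v x) - (u y + a * v y)) * (w x - w y)
      = c x y * (u x - u y) * (w x - w y) + a * (c x y * (v x - v y) * (w x - w y))" for x y
    by (simp add: algebra_simps)
  then show ?thesis
    unfolding boundary_energy_def
    by (simp only: sum.distrib sum_distrib_left[symmetric] add_divide_distrib
        times_divide_eq_right)
qed

lemma boundary_energy_sym: "\<E>\<^sub>0 u v = \<E>\<^sub>0 v u"
  unfolding boundary_energy_def by (simp add: mult.assoc mult.commute[of "u _ - u _"])

sublocale level: form_space UNIV "level m" for m
proof
  fix u v w :: "'a \<Rightarrow> real" and a :: real
  show "level m u v = level m v u"
    by (simp add: level_eq boundary_energy_sym)
  show "level m (\<lambda>x. u x + a * v x) w = level m u w + a * level m v w"
    by (simp add: level_eq comp_def boundary_energy_lin sum.distrib sum_distrib_left algebra_simps)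
  show "0 \<le> level m u u"
    unfolding level_eq using weight_pos
    by (intro sum_nonneg mult_nonneg_nonneg boundary_energy_nonneg) (simp add: less_imp_le)
qed simp_all

lemma level_nonneg: "0 \<le> level m u u"
  by (rule level.nonneg) simp

lemma level_cong:
  assumes "\<And>x. x \<in> vertices m \<Longrightarrow> u x = u' x" "\<And>x. x \<in> vertices m \<Longrightarrow> v x = v' x"
  shows "level m u v = level m u' v'"
  unfolding level_eq using assms
  by (intro sum.cong refl arg_cong2[where f = "(*)"] boundary_energy_cong)
    (auto simp: vertices_def)

text \<open>Self-similarity of the energy: words of length \<open>m + n\<close> split uniquely into a prefix and a
  suffix.\<close>

lemma level_add:
  "level (m + n) u v =
     (\<Sum>w | length w = m. inverse (weight w) * level n (u \<circ> foldr F w) (v \<circ> foldr F w))"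
proof -
  have app: "foldr F (w @ t) = foldr F w \<circ> foldr F t" for w t by (rule ext) simp
  let ?g = "\<lambda>w. inverse (weight w) * \<E>\<^sub>0 (u \<circ> foldr F w) (v \<circ> foldr F w)"
  let ?A = "{w :: 'i list. length w = m}" and ?B = "{w :: 'i list. length w = n}"
  have bij: "bij_betw (\<lambda>(w, t). w @ t) (?A \<times> ?B) {w. length w = m + n}"
    by (rule bij_betw_byWitness[where f' = "\<lambda>w. (take m w, drop m w)"]) auto
  have "level (m + n) u v = (\<Sum>(w, t)\<in>?A \<times> ?B. ?g (w @ t))"
    unfolding level_eq by (subst sum.reindex_bij_betw[OF bij, symmetric]) (simp add: case_prod_beta)
  also have "\<dots> = (\<Sum>w\<in>?A. \<Sum>t\<in>?B. ?g (w @ t))"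
    by (rule sum.cartesian_product[symmetric])
  also have "\<dots> = (\<Sum>w\<in>?A. inverse (weight w) * level n (u \<circ> foldr F w) (v \<circ> foldr F w))"
    by (simp add: level_eq sum_distrib_left weight_append comp_assoc app mult.assoc
        del: comp_apply)
  finally show ?thesis .
qed

lemma boundary_energy_0: "\<E>\<^sub>0 u u = 0 \<Longrightarrow> \<exists>a. \<forall>x\<in>V\<^sub>0. u x = a"
  using harmonic by (simp add: regular_harmonic_structure_def)

lemma minimal_extension: "\<exists>v. (\<forall>x\<in>V\<^sub>0. v x = u x) \<and> level 1 v v = \<E>\<^sub>0 u u"
  using harmonic by (simp add: regular_harmonic_structure_def)

lemma boundary_le_level_1: "\<E>\<^sub>0 u u \<le> level 1 u u"
  using harmonic by (simp add: regular_harmonic_structure_def)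

lemma level_Suc_ge: "level m u u \<le> level (Suc m) u u"
proof -
  have "level (m + 0) u u \<le> level (m + 1) u u"
    unfolding level_add using weight_pos
    by (intro sum_mono mult_left_mono) (auto simp: level_0 less_imp_le intro!: boundary_le_level_1[simplified])
  then show ?thesis by simp
qed

lemma level_mono: "m \<le> n \<Longrightarrow> level m u u \<le> level n u u"
  by (rule lift_Suc_mono_le[of "\<lambda>m. level m u u", OF level_Suc_ge])

text \<open>Dropping all but one of the cells of level \<open>length w\<close> in \<open>level_add\<close>: the energy inside the
  cell \<open>w\<close> comes with the small factor \<open>weight w\<close>.\<close>

lemma level_word: "level n (u \<circ> foldr F w) (u \<circ> foldr F w) \<le> weight w * level (length w + n) u u"
proof -
  have "inverse (weight w) * level n (u \<circ> foldr F w) (u \<circ> foldr F w) \<le> level (length w + n) u u"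
    unfolding level_add using weight_pos finite_words
    by (intro member_le_sum) (auto intro!: mult_nonneg_nonneg level_nonneg simp: less_imp_le)
  then show ?thesis using weight_pos[of w] by (simp add: field_simps)
qed

text \<open>The constant may depend on the pair of points, which makes the relation transitive for free; it
  is made uniform afterwards, over finitely many pairs.\<close>

definition controlled :: "nat \<Rightarrow> 'a \<Rightarrow> 'a \<Rightarrow> bool" where
  "controlled m x y \<longleftrightarrow> (\<exists>C\<ge>0. \<forall>u. \<bar>u x - u y\<bar> \<le> C * sqrt (level m u u))"

lemma controlled_refl: "controlled m x x"
  by (auto simp: controlled_def)

lemma controlled_trans:
  assumes "controlled m x y" "controlled m y z"
  shows "controlled m x z"
proof -
  obtain C C' where C: "C \<ge> 0" "\<And>u. \<bar>u x - u y\<bar> \<le> C * sqrt (level m u u)"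
    and C': "C' \<ge> 0" "\<And>u. \<bar>u y - u z\<bar> \<le> C' * sqrt (level m u u)"
    using assms by (auto simp: controlled_def)
  have "\<bar>u x - u z\<bar> \<le> (C + C') * sqrt (level m u u)" for u
    using C(2)[of u] C'(2)[of u] by (simp add: algebra_simps)
  then show ?thesis using C C' unfolding controlled_def by (intro exI[of _ "C + C'"]) auto
qed

lemma controlled_edge:
  assumes "x \<in> V\<^sub>0" "y \<in> V\<^sub>0" "0 < c x y"
  shows "controlled 0 x y"
proof -
  have "\<bar>u x - u y\<bar> \<le> sqrt (2 / c x y) * sqrt (level 0 u u)" for u
  proof -
    let ?t = "\<lambda>x y. c x y * (u x - u y) * (u x - u y)"
    have nn: "0 \<le> ?t x y" if "x \<in> V\<^sub>0" "y \<in> V\<^sub>0" for x y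
      using c_nonneg[OF that] by (simp add: mult.assoc)
    have "?t x y \<le> (\<Sum>y\<in>V\<^sub>0. ?t x y)"
      using assms nn finite_boundary by (intro member_le_sum) auto
    also have "\<dots> \<le> (\<Sum>x\<in>V\<^sub>0. \<Sum>y\<in>V\<^sub>0. ?t x y)"
      using assms nn finite_boundary by (intro member_le_sum[of x V\<^sub>0 "\<lambda>x. \<Sum>y\<in>V\<^sub>0. ?t x y"]) (auto intro!: sum_nonneg)
    also have "\<dots> = 2 * level 0 u u" by (simp add: level_0 boundary_energy_def)
    finally have "(u x - u y)\<^sup>2 \<le> 2 / c x y * level 0 u u"
      using assms(3) by (simp add: power2_eq_square field_simps)
    then have "sqrt ((u x - u y)\<^sup>2) \<le> sqrt (2 / c x y * level 0 u u)" by (rule real_sqrt_le_mono)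
    then show ?thesis by (simp only: real_sqrt_mult real_sqrt_abs)
  qed
  then show ?thesis
    unfolding controlled_def using assms(3) by (intro exI[of _ "sqrt (2 / c x y)"]) auto
qed

text \<open>The indicator function of the set of points controlled from \<open>x\<close> has energy zero, since there are
  no conductances between this set and its complement.  Such a function is constant on \<open>V\<^sub>0\<close>.\<close>

lemma controlled_boundary:
  assumes x: "x \<in> V\<^sub>0" and y: "y \<in> V\<^sub>0"
  shows "controlled 0 x y"
proof -
  define u :: "'a \<Rightarrow> real" where "u z = of_bool (controlled 0 x z)" for z
  have "c p q * (u p - u q) * (u p - u q) = 0" if "p \<in> V\<^sub>0" "q \<in> V\<^sub>0" for p q
  proof (cases "c p q = 0")
    case False
    then have "controlled 0 p q" "controlled 0 q p"
      using controlled_edge c_nonneg[of p q] c_nonneg[of q p] c_sym[of p q] that by auto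
    then have "controlled 0 x p \<longleftrightarrow> controlled 0 x q"
      using controlled_trans[of 0 x p q] controlled_trans[of 0 x q p] by blast
    then have "u p = u q" by (simp add: u_def)
    then show ?thesis by simp
  qed simp
  then have "(\<Sum>p\<in>V\<^sub>0. \<Sum>q\<in>V\<^sub>0. c p q * (u p - u q) * (u p - u q)) = 0"
    by (intro sum.neutral ballI)
  then have "\<E>\<^sub>0 u u = 0" unfolding boundary_energy_def by simp
  then obtain a where "\<forall>z\<in>V\<^sub>0. u z = a"
    using boundary_energy_0 by blast
  then have "u y = u x" using x y by simp
  then show ?thesis using controlled_refl[of 0 x] by (simp add: u_def split: if_splits)
qed

lemma controlled_cell:
  assumes "x \<in> V\<^sub>0" "y \<in> V\<^sub>0"
  shows "controlled 1 (F i x) (F i y)"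
proof -
  obtain C where C: "C \<ge> 0" "\<And>u. \<bar>u x - u y\<bar> \<le> C * sqrt (level 0 u u)"
    using controlled_boundary[OF assms] by (auto simp: controlled_def)
  have "\<bar>u (F i x) - u (F i y)\<bar> \<le> C * sqrt (level 1 u u)" for u
  proof -
    have "level 0 (u \<circ> foldr F [i]) (u \<circ> foldr F [i]) \<le> weight [i] * level 1 u u"
      using level_word[of 0 u "[i]"] by simp
    also have "\<dots> \<le> 1 * level 1 u u"
      using r_less_1[of i] by (intro mult_right_mono level_nonneg) (simp add: weight_def)
    finally have "C * sqrt (level 0 (u \<circ> foldr F [i]) (u \<circ> foldr F [i])) \<le> C * sqrt (level 1 u u)"
      using C(1) by (intro mult_left_mono real_sqrt_le_mono) auto
    then show ?thesis using C(2)[of "u \<circ> foldr F [i]"] by simp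
  qed
  then show ?thesis using C(1) unfolding controlled_def by blast
qed

lemma vertices_1: "vertices 1 = (\<Union>i. F i ` V\<^sub>0)"
proof -
  have "{w :: 'i list. length w = 1} = range (\<lambda>i. [i])"
    by (auto simp: length_Suc_conv)
  then show ?thesis by (simp add: vertices_def)
qed

text \<open>Touching cells share a vertex, through which control passes from one to the next; by
  connectedness it reaches every cell.\<close>

lemma controlled_vertices_1:
  assumes "x \<in> vertices 1" "y \<in> vertices 1"
  shows "controlled 1 x y"
proof -
  obtain i p where x: "p \<in> V\<^sub>0" "x = F i p" using assms(1) unfolding vertices_1 by blast
  define S where "S = {j. \<forall>q\<in>V\<^sub>0. controlled 1 x (F j q)}"
  have "S = UNIV"
  proof (rule cells_chain)
    show "S \<noteq> {}" using controlled_cell[OF x(1)] x(2) by (auto simp: S_def)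
    fix j k assume j: "j \<in> S" and meet: "F j ` K \<inter> F k ` K \<noteq> {}"
    show "k \<in> S"
    proof (cases "j = k")
      case False
      obtain z where "z \<in> F j ` K \<inter> F k ` K" using meet by blast
      then have "z \<in> F j ` V\<^sub>0 \<inter> F k ` V\<^sub>0"
        using cells_meet_in_boundary[OF pcf False] by (rule rev_subsetD)
      then obtain q q' where q: "q \<in> V\<^sub>0" "q' \<in> V\<^sub>0" "F j q = F k q'" by auto
      then have "controlled 1 x (F k q')" using j by (auto simp: S_def)
      then show ?thesis using controlled_cell[OF q(2), of _ k] controlled_trans
        by (auto simp: S_def)
    qed (use j in simp)
  qed
  moreover obtain j q where "q \<in> V\<^sub>0" "y = F j q" using assms(2) unfolding vertices_1 by blast
  ultimately show ?thesis by (auto simp: S_def)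
qed

lemma finite_vertices: "finite (vertices m)"
  unfolding vertices_def using finite_words finite_boundary by blast

lemma oscillation_vertices_1:
  obtains C where "0 < C"
    "\<And>u x y. x \<in> vertices 1 \<Longrightarrow> y \<in> vertices 1 \<Longrightarrow> \<bar>u x - u y\<bar> \<le> C * sqrt (level 1 u u)"
proof -
  let ?V = "vertices 1"
  have "\<forall>p. \<exists>C\<ge>0. p \<in> ?V \<times> ?V \<longrightarrow> (\<forall>u. \<bar>u (fst p) - u (snd p)\<bar> \<le> C * sqrt (level 1 u u))"
    using controlled_vertices_1 unfolding controlled_def by (metis mem_Times_iff order_refl)
  then obtain C where C: "\<And>p. C p \<ge> 0"
      "\<And>p u. p \<in> ?V \<times> ?V \<Longrightarrow> \<bar>u (fst p) - u (snd p)\<bar> \<le> C p * sqrt (level 1 u u)"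
    by metis
  define M where "M = (\<Sum>p\<in>?V \<times> ?V. C p) + 1"
  have "M > 0" unfolding M_def using C(1) by (intro add_nonneg_pos sum_nonneg) auto
  moreover have "\<bar>u x - u y\<bar> \<le> M * sqrt (level 1 u u)" if "x \<in> ?V" "y \<in> ?V" for u x y
  proof -
    have "C (x, y) \<le> (\<Sum>p\<in>?V \<times> ?V. C p)"
      using that finite_vertices C(1) by (intro member_le_sum) auto
    then have "C (x, y) \<le> M" by (simp add: M_def)
    then have "C (x, y) * sqrt (level 1 u u) \<le> M * sqrt (level 1 u u)"
      by (intro mult_right_mono) (simp_all add: level_nonneg)
    then show ?thesis using C(2)[of "(x, y)" u] that by simp
  qed
  ultimately show thesis using that by blast
qed

lemma resistance_ratio:
  obtains \<rho> where "0 < \<rho>" "\<rho> < 1" "\<And>w. weight w \<le> \<rho> ^ length w"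
proof -
  define \<rho> where "\<rho> = Max (range r)"
  have le: "r i \<le> \<rho>" for i unfolding \<rho>_def by (rule Max_ge) auto
  have "\<rho> \<in> range r" unfolding \<rho>_def by (rule Max_in) auto
  then have \<rho>: "0 < \<rho>" "\<rho> < 1" using r_pos r_less_1 by auto
  have "weight w \<le> \<rho> ^ length w" for w
  proof (induction w)
    case (Cons i w)
    have "r i * weight w \<le> \<rho> * \<rho> ^ length w"
      using Cons.IH le \<rho> weight_pos[of w] by (intro mult_mono) (auto simp: less_imp_le)
    then show ?case by (simp add: weight_def)
  qed (simp add: weight_def)
  with \<rho> that show thesis by blast
qed

text \<open>No continuity is required, so that the estimates below apply to functions that are
  so far known only on the vertices, such as a harmonic extension under construction.\<close>

definition bounded_energy :: "real \<Rightarrow> ('a \<Rightarrow> real) \<Rightarrow> bool" where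
  "bounded_energy M u \<longleftrightarrow> (\<forall>m. level m u u \<le> M)"

lemma bounded_energy_word:
  assumes "bounded_energy M u"
  shows "bounded_energy (weight w * M) (u \<circ> foldr F w)"
  unfolding bounded_energy_def
proof
  fix m
  have "weight w * level (length w + m) u u \<le> weight w * M"
    using assms weight_pos[of w] by (intro mult_left_mono) (auto simp: bounded_energy_def less_imp_le)
  then show "level m (u \<circ> foldr F w) (u \<circ> foldr F w) \<le> weight w * M"
    using level_word[of m u w] by linarith
qed

lemma bounded_energy_mono: "bounded_energy M u \<Longrightarrow> M \<le> M' \<Longrightarrow> bounded_energy M' u"
  unfolding bounded_energy_def by (meson order_trans)

lemma bounded_energy_nonneg: "bounded_energy M u \<Longrightarrow> 0 \<le> M"
  unfolding bounded_energy_def using level_nonneg[of 0 u] by (meson order_trans)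

text \<open>A vertex of level \<open>n + 1\<close> is reached from \<open>p\<close> by a step between vertices of level one,
  which costs \<open>C\<^sub>1\<close>, and a path inside a single cell, which costs at most \<open>C * sqrt \<rho>\<close> by
  induction applied to the rescaled function.  The bound persists through the levels because \<open>C\<close>
  solves \<open>C = C\<^sub>1 + C * sqrt \<rho>\<close>.\<close>

lemma oscillation_all_vertices:
  obtains C where "0 < C"
    "\<And>u M x y. bounded_energy M u \<Longrightarrow> x \<in> all_vertices \<Longrightarrow> y \<in> all_vertices \<Longrightarrow> \<bar>u x - u y\<bar> \<le> C * sqrt M"
proof -
  obtain C\<^sub>1 where C1: "0 < C\<^sub>1" "\<And>u x y. x \<in> vertices 1 \<Longrightarrow> y \<in> vertices 1 \<Longrightarrow> \<bar>u x - u y\<bar> \<le> C\<^sub>1 * sqrt (level 1 u u)"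
    using oscillation_vertices_1 by blast
  obtain \<rho> where \<rho>: "0 < \<rho>" "\<rho> < 1" "\<And>w. weight w \<le> \<rho> ^ length w"
    using resistance_ratio by blast
  obtain p where p: "p \<in> V\<^sub>0" using V0_ne by blast
  have p1: "p \<in> vertices 1" using p vertices_0 vertices_mono[of 0 1] by auto
  have \<rho>': "0 < sqrt \<rho>" "sqrt \<rho> < 1" using \<rho> by auto
  define C where "C = C\<^sub>1 / (1 - sqrt \<rho>)"
  have C: "0 < C" "C\<^sub>1 + C * sqrt \<rho> = C"
    using C1 \<rho>' by (auto simp: C_def field_simps)
  then have "C\<^sub>1 \<le> C" using \<rho>' by (smt (verit) mult_pos_pos)
  have main: "\<bar>u x - u p\<bar> \<le> C * sqrt M" if "x \<in> vertices n" "bounded_energy M u" for n u M x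
    using that
  proof (induction n arbitrary: u M x)
    case 0
    have "C\<^sub>1 * sqrt (level 1 u u) \<le> C * sqrt M"
      using 0(2) \<open>C\<^sub>1 \<le> C\<close> C1 level_nonneg C(1)
      by (intro mult_mono real_sqrt_le_mono) (auto simp: bounded_energy_def)
    then show ?case using C1(2)[of x p u] 0(1) p1 vertices_mono[of 0 1] by fastforce
  next
    case (Suc n)
    obtain w y where w: "length w = 1" "y \<in> vertices n" "x = foldr F w y"
      using vertices_split[of x 1 n] Suc.prems(1) by auto
    then obtain i where i: "w = [i]" by (auto simp: length_Suc_conv)
    have M: "0 \<le> M" using bounded_energy_nonneg[OF Suc.prems(2)] .
    have "weight w * M \<le> \<rho> * M" using \<rho>(3)[of w] w(1) M by (intro mult_right_mono) auto
    then have "bounded_energy (\<rho> * M) (u \<circ> foldr F w)"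
      using bounded_energy_word[OF Suc.prems(2)] bounded_energy_mono by blast
    then have "\<bar>u x - u (F i p)\<bar> \<le> C * sqrt (\<rho> * M)"
      using Suc.IH[OF w(2)] w(3) i by fastforce
    moreover have "\<bar>u (F i p) - u p\<bar> \<le> C\<^sub>1 * sqrt (level 1 u u)"
      using p p1 by (intro C1(2)) (auto simp: vertices_1[simplified])
    moreover have "C\<^sub>1 * sqrt (level 1 u u) \<le> C\<^sub>1 * sqrt M"
      using Suc.prems(2) C1 by (intro mult_left_mono real_sqrt_le_mono) (auto simp: bounded_energy_def)
    ultimately have "\<bar>u x - u p\<bar> \<le> (C\<^sub>1 + C * sqrt \<rho>) * sqrt M"
      by (simp add: real_sqrt_mult algebra_simps)
    then show ?case using C(2) by simp
  qed
  have "\<bar>u x - u y\<bar> \<le> (2 * C) * sqrt M"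
    if "bounded_energy M u" "x \<in> all_vertices" "y \<in> all_vertices" for u M x y
  proof -
    have "\<bar>u x - u p\<bar> \<le> C * sqrt M" "\<bar>u y - u p\<bar> \<le> C * sqrt M"
      using main that by (auto simp: all_vertices_def)
    then show ?thesis by linarith
  qed
  then show thesis using C(1) by (intro that[of "2 * C"]) auto
qed

text \<open>Choose a level at which the oscillation over any cell is below \<open>\<epsilon> / 2\<close>.  Points at small
  distance lie in touching cells, and these share a vertex.\<close>

lemma equicontinuous_all_vertices:
  assumes "0 < \<epsilon>"
  obtains \<delta> where "0 < \<delta>"
    "\<And>u M x y. bounded_energy M u \<Longrightarrow> x \<in> all_vertices \<Longrightarrow> y \<in> all_vertices \<Longrightarrow> dist x y < \<delta> \<Longrightarrow>
       \<bar>u x - u y\<bar> \<le> \<epsilon> * sqrt M"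
proof -
  obtain C where C: "0 < C" "\<And>u M x y. bounded_energy M u \<Longrightarrow> x \<in> all_vertices \<Longrightarrow>
      y \<in> all_vertices \<Longrightarrow> \<bar>u x - u y\<bar> \<le> C * sqrt M"
    using oscillation_all_vertices by blast
  obtain \<rho> where \<rho>: "0 < \<rho>" "\<rho> < 1" "\<And>w. weight w \<le> \<rho> ^ length w"
    using resistance_ratio by blast
  have "(\<lambda>m. 2 * C * sqrt \<rho> ^ m) \<longlonglongrightarrow> 2 * C * 0"
    using \<rho> by (intro tendsto_mult LIMSEQ_power_zero tendsto_const) auto
  then have "\<forall>\<^sub>F m in sequentially. 2 * C * sqrt \<rho> ^ m < \<epsilon>"
    by (rule order_tendstoD(2)) (use assms in simp)
  then obtain m where m: "2 * C * sqrt \<rho> ^ m < \<epsilon>"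
    by (auto simp: eventually_sequentially)
  obtain \<delta> where \<delta>: "0 < \<delta>"
    "\<And>w w' a b. length w = m \<Longrightarrow> length w' = m \<Longrightarrow> a \<in> foldr F w ` K \<Longrightarrow> b \<in> foldr F w' ` K \<Longrightarrow>
       dist a b < \<delta> \<Longrightarrow> foldr F w ` K \<inter> foldr F w' ` K \<noteq> {}"
    using cells_separated[of m] by blast
  show thesis
  proof (rule that[OF \<delta>(1)])
    fix u M x y
    assume u: "bounded_energy M u" and x: "x \<in> all_vertices" and y: "y \<in> all_vertices"
      and "dist x y < \<delta>"
    have M: "0 \<le> M" using bounded_energy_nonneg[OF u] .
    have cell: "\<bar>u (foldr F w a) - u (foldr F w b)\<bar> \<le> C * sqrt \<rho> ^ m * sqrt M"
      if "length w = m" "a \<in> all_vertices" "b \<in> all_vertices" for w a b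
    proof -
      have "weight w * M \<le> \<rho> ^ m * M" using \<rho>(3)[of w] that(1) M by (intro mult_right_mono) auto
      then have "bounded_energy (\<rho> ^ m * M) (u \<circ> foldr F w)"
        using bounded_energy_word[OF u] bounded_energy_mono by blast
      from C(2)[OF this that(2,3)] show ?thesis by (simp add: real_sqrt_mult real_sqrt_power mult.assoc)
    qed
    obtain w a where w: "length w = m" "a \<in> all_vertices" "x = foldr F w a"
      using all_vertices_split[OF x] .
    obtain w' b where w': "length w' = m" "b \<in> all_vertices" "y = foldr F w' b"
      using all_vertices_split[OF y] .
    have "a \<in> K" "b \<in> K" using w w' all_vertices_subset by auto
    then obtain a' b' where ab': "a' \<in> K" "b' \<in> K" "foldr F w a' = foldr F w' b'"
      using \<delta>(2)[of w w' x y] w w' \<open>dist x y < \<delta>\<close> by blast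
    have "\<bar>u x - u y\<bar> \<le> 2 * C * sqrt \<rho> ^ m * sqrt M"
    proof (cases "w = w'")
      case True
      have "0 \<le> C * sqrt \<rho> ^ m * sqrt M" using C(1) \<rho>(1) M by simp
      then show ?thesis using cell[of w a b] w w' True by simp
    next
      case False
      then have "a' \<in> V\<^sub>0" "b' \<in> V\<^sub>0"
        using words_meet_in_boundary[of w w' a' b'] words_meet_in_boundary[of w' w b' a'] w w' ab'
        by simp_all
      then have "a' \<in> all_vertices" "b' \<in> all_vertices" using boundary_all by blast+
      then show ?thesis
        using cell[OF w(1,2), of a'] cell[OF w'(1,2), of b'] w(3) w'(3) ab'(3) by simp
    qed
    also have "\<dots> \<le> \<epsilon> * sqrt M" using m M by (intro mult_right_mono) auto
    finally show "\<bar>u x - u y\<bar> \<le> \<epsilon> * sqrt M" .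
  qed
qed

lemma dense_oscillation:
  assumes cont: "continuous_on K (u :: 'a \<Rightarrow> real)"
    and bound: "\<And>a b. a \<in> all_vertices \<Longrightarrow> b \<in> all_vertices \<Longrightarrow> dist a b < \<delta> \<Longrightarrow> \<bar>u a - u b\<bar> \<le> B"
    and x: "x \<in> K" and y: "y \<in> K" and "dist x y < \<delta>"
  shows "\<bar>u x - u y\<bar> \<le> B"
proof -
  obtain s where s: "\<And>n. s n \<in> all_vertices" "s \<longlonglongrightarrow> x"
    using dense_vertices[OF V0_ne] x closure_sequential by metis
  obtain t where t: "\<And>n. t n \<in> all_vertices" "t \<longlonglongrightarrow> y"
    using dense_vertices[OF V0_ne] y closure_sequential by metis
  have "(\<lambda>n. u (s n)) \<longlonglongrightarrow> u x" "(\<lambda>n. u (t n)) \<longlonglongrightarrow> u y"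
    using s t x y all_vertices_subset
    by (auto intro!: continuous_on_tendsto_compose[OF cont] eventuallyI)
  then have lim: "(\<lambda>n. \<bar>u (s n) - u (t n)\<bar>) \<longlonglongrightarrow> \<bar>u x - u y\<bar>"
    by (intro tendsto_intros)
  have "(\<lambda>n. dist (s n) (t n)) \<longlonglongrightarrow> dist x y" by (intro tendsto_intros s t)
  then have "\<forall>\<^sub>F n in sequentially. dist (s n) (t n) < \<delta>"
    using \<open>dist x y < \<delta>\<close> by (rule order_tendstoD(2))
  then have "\<forall>\<^sub>F n in sequentially. \<bar>u (s n) - u (t n)\<bar> \<le> B"
    by (rule eventually_mono) (intro bound s t)
  then show ?thesis using lim by (intro tendsto_upperbound) auto
qed

end

section \<open>The energy form\<close>

context harmonic_structure
begin

abbreviation dom :: "('a \<Rightarrow> real) set" where "dom \<equiv> dom_energy K F r c"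

abbreviation \<E> :: "('a \<Rightarrow> real) \<Rightarrow> ('a \<Rightarrow> real) \<Rightarrow> real" where "\<E> \<equiv> energy K F r c"

lemma dom_continuous: "u \<in> dom \<Longrightarrow> continuous_on K u"
  by (simp add: dom_energy_def)

lemma dom_tendsto: "u \<in> dom \<Longrightarrow> (\<lambda>m. level m u u) \<longlonglongrightarrow> \<E> u u"
  by (simp add: dom_energy_def energy_def convergent_LIMSEQ_iff)

lemma dom_bounded_energy:
  assumes "u \<in> dom"
  shows "bounded_energy (\<E> u u) u"
  unfolding bounded_energy_def
proof
  fix m show "level m u u \<le> \<E> u u"
    using level_mono by (intro incseq_le[OF _ dom_tendsto[OF assms]]) (simp add: incseq_def)
qed

lemma domI:
  assumes "continuous_on K u" "bounded_energy M u"
  shows "u \<in> dom"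
proof -
  have "incseq (\<lambda>m. level m u u)" using level_mono by (simp add: incseq_def)
  moreover have "\<And>m. level m u u \<le> M" using assms by (simp add: bounded_energy_def)
  ultimately obtain L where "(\<lambda>m. level m u u) \<longlonglongrightarrow> L"
    using incseq_convergent[of "\<lambda>m. level m u u" M] by blast
  then show ?thesis using assms by (auto simp: dom_energy_def convergent_def)
qed

lemma energy_le: "u \<in> dom \<Longrightarrow> bounded_energy M u \<Longrightarrow> \<E> u u \<le> M"
  using dom_tendsto by (intro LIMSEQ_le_const2[OF dom_tendsto]) (auto simp: bounded_energy_def)

text \<open>The parallelogram identity, with the energy of \<open>u - a v\<close> discarded.\<close>

lemma bounded_energy_lin:
  assumes "bounded_energy M u" "bounded_energy M' v"
  shows "bounded_energy (2 * M + 2 * a\<^sup>2 * M') (\<lambda>x. u x + a * v x)"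
  unfolding bounded_energy_def
proof
  fix m
  have "level m (\<lambda>x. u x + a * v x) (\<lambda>x. u x + a * v x) + level m (\<lambda>x. u x + (- a) * v x) (\<lambda>x. u x + (- a) * v x)
      = 2 * level m u u + 2 * a\<^sup>2 * level m v v"
    using level.quad[of u v m a] level.quad[of u v m "- a"] by simp
  moreover have "0 \<le> level m (\<lambda>x. u x + (- a) * v x) (\<lambda>x. u x + (- a) * v x)" by (rule level_nonneg)
  moreover have "2 * a\<^sup>2 * level m v v \<le> 2 * a\<^sup>2 * M'"
    using assms by (intro mult_left_mono) (auto simp: bounded_energy_def)
  moreover have "level m u u \<le> M" using assms by (simp add: bounded_energy_def)
  ultimately show "level m (\<lambda>x. u x + a * v x) (\<lambda>x. u x + a * v x) \<le> 2 * M + 2 * a\<^sup>2 * M'"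
    by linarith
qed

lemma dom_lin:
  assumes "u \<in> dom" "v \<in> dom"
  shows "(\<lambda>x. u x + a * v x) \<in> dom"
  using assms
  by (intro domI[OF _ bounded_energy_lin[OF dom_bounded_energy dom_bounded_energy]] continuous_intros)
    (auto dest: dom_continuous)

text \<open>The domain only provides convergence on the diagonal; polarization gives the rest.\<close>

lemma energy_tendsto:
  assumes "u \<in> dom" "v \<in> dom"
  shows "(\<lambda>m. level m u v) \<longlonglongrightarrow> \<E> u v"
proof -
  have "(\<lambda>m. (level m (\<lambda>x. u x + 1 * v x) (\<lambda>x. u x + 1 * v x) - level m u u - level m v v) / 2)
      \<longlonglongrightarrow> (\<E> (\<lambda>x. u x + 1 * v x) (\<lambda>x. u x + 1 * v x) - \<E> u u - \<E> v v) / 2"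
    using assms by (intro tendsto_intros dom_tendsto dom_lin) auto
  moreover have "(level m (\<lambda>x. u x + 1 * v x) (\<lambda>x. u x + 1 * v x) - level m u u - level m v v) / 2
      = level m u v" for m
    using level.quad[of u v m 1] by simp
  ultimately have "convergent (\<lambda>m. level m u v)" by (auto simp: convergent_def)
  then show ?thesis by (simp add: energy_def convergent_LIMSEQ_iff)
qed

lemma const_dom: "(\<lambda>_. a) \<in> dom"
proof (rule domI)
  show "bounded_energy 0 (\<lambda>_. a)"
    by (simp add: bounded_energy_def level_eq boundary_energy_def comp_def)
qed simp

sublocale form_space dom \<E>
proof
  show "(\<lambda>_. 0) \<in> dom" by (rule const_dom)
  fix u v assume u: "u \<in> dom" and v: "v \<in> dom"
  show "(\<lambda>x. u x + a * v x) \<in> dom" for a using u v by (rule dom_lin)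
  show "\<E> u v = \<E> v u" unfolding energy_def using level.commute by simp
  show "0 \<le> \<E> u u" using dom_tendsto[OF u] level_nonneg by (intro LIMSEQ_le_const) auto
  fix w a assume w: "w \<in> dom"
  have "(\<lambda>m. level m (\<lambda>x. u x + a * v x) w) \<longlonglongrightarrow> \<E> u w + a * \<E> v w"
    unfolding level.lin[OF UNIV_I UNIV_I UNIV_I] by (intro tendsto_intros energy_tendsto u v w)
  then show "\<E> (\<lambda>x. u x + a * v x) w = \<E> u w + a * \<E> v w"
    using energy_tendsto[OF dom_lin[OF u v] w] by (rule LIMSEQ_unique[rotated])
qed

lemma vertices_subset: "vertices m \<subseteq> K"
  using all_vertices_subset by (auto simp: all_vertices_def)

lemma energy_cong:
  assumes "\<And>x. x \<in> K \<Longrightarrow> u x = u' x" "\<And>x. x \<in> K \<Longrightarrow> v x = v' x"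
  shows "\<E> u v = \<E> u' v'"
proof -
  have "level m u v = level m u' v'" for m
    using assms vertices_subset by (intro level_cong) auto
  then show ?thesis by (simp add: energy_def)
qed

text \<open>Only the values on \<open>K\<close> count.  This will matter for the Green's function, whose defining
  integral is known to agree with a given function of the domain only on \<open>K\<close>.\<close>

lemma dom_cong:
  assumes "\<And>x. x \<in> K \<Longrightarrow> u x = u' x" "u \<in> dom"
  shows "u' \<in> dom"
proof (rule domI)
  show "continuous_on K u'"
    using dom_continuous[OF assms(2)] assms(1) by (simp cong: continuous_on_cong)
  have "level m u' u' = level m u u" for m
    using assms(1) vertices_subset by (intro level_cong) (auto simp: subset_iff)
  then show "bounded_energy (\<E> u u) u'"
    using dom_bounded_energy[OF assms(2)] by (simp add: bounded_energy_def)
qed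

lemma oscillation:
  obtains C where "0 < C"
    "\<And>u x y. u \<in> dom \<Longrightarrow> x \<in> K \<Longrightarrow> y \<in> K \<Longrightarrow> \<bar>u x - u y\<bar> \<le> C * sqrt (\<E> u u)"
proof -
  obtain C where C: "0 < C" "\<And>u M x y. bounded_energy M u \<Longrightarrow> x \<in> all_vertices \<Longrightarrow>
      y \<in> all_vertices \<Longrightarrow> \<bar>u x - u y\<bar> \<le> C * sqrt M"
    using oscillation_all_vertices by blast
  have "\<bar>u x - u y\<bar> \<le> C * sqrt (\<E> u u)" if "u \<in> dom" "x \<in> K" "y \<in> K" for u x y
    by (rule dense_oscillation[where \<delta> = "dist x y + 1"])
      (use that C(2) dom_bounded_energy in \<open>auto intro: dom_continuous\<close>)
  with C(1) that show thesis by blast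
qed

lemma equicontinuous:
  assumes "0 < \<epsilon>"
  obtains \<delta> where "0 < \<delta>"
    "\<And>u x y. u \<in> dom \<Longrightarrow> x \<in> K \<Longrightarrow> y \<in> K \<Longrightarrow> dist x y < \<delta> \<Longrightarrow> \<bar>u x - u y\<bar> \<le> \<epsilon> * sqrt (\<E> u u)"
proof -
  obtain \<delta> where \<delta>: "0 < \<delta>" "\<And>u M x y. bounded_energy M u \<Longrightarrow> x \<in> all_vertices \<Longrightarrow>
      y \<in> all_vertices \<Longrightarrow> dist x y < \<delta> \<Longrightarrow> \<bar>u x - u y\<bar> \<le> \<epsilon> * sqrt M"
    using equicontinuous_all_vertices[OF assms] by blast
  have "\<bar>u x - u y\<bar> \<le> \<epsilon> * sqrt (\<E> u u)" if "u \<in> dom" "x \<in> K" "y \<in> K" "dist x y < \<delta>" for u x y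
    by (rule dense_oscillation[where \<delta> = \<delta>])
      (use that \<delta>(2) dom_bounded_energy in \<open>auto intro: dom_continuous\<close>)
  with \<delta>(1) that show thesis by blast
qed

lemma dom_word:
  assumes "u \<in> dom"
  shows "u \<circ> foldr F w \<in> dom"
proof (rule domI)
  show "continuous_on K (u \<circ> foldr F w)"
    using dom_continuous[OF assms] word_mem
    by (intro continuous_on_compose continuous_word) (auto elim: continuous_on_subset)
  show "bounded_energy (weight w * \<E> u u) (u \<circ> foldr F w)"
    by (intro bounded_energy_word dom_bounded_energy assms)
qed

text \<open>The oscillation bound makes a Cauchy sequence that vanishes at one point uniformly Cauchy on \<open>K\<close>.
  Each level energy involves finitely many points and is continuous under pointwise limits; this
  bounds the energy of the distance to the limit.\<close>

lemma complete_vanishing: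
  assumes e: "e \<in> K"
    and s: "\<And>n. s n \<in> dom" "\<And>n. s n e = 0"
    and cauchy: "\<And>\<epsilon>. \<epsilon> > 0 \<Longrightarrow> \<exists>N. \<forall>m\<ge>N. \<forall>n\<ge>N. \<E> (\<lambda>x. s m x - s n x) (\<lambda>x. s m x - s n x) \<le> \<epsilon>"
  obtains u where "u \<in> dom" "\<And>x. x \<in> K \<Longrightarrow> (\<lambda>n. s n x) \<longlonglongrightarrow> u x"
    "(\<lambda>n. \<E> (\<lambda>x. s n x - u x) (\<lambda>x. s n x - u x)) \<longlonglongrightarrow> 0"
proof -
  let ?d = "\<lambda>m n x. s m x - s n x"
  obtain C where C: "0 < C"
      "\<And>u x y. u \<in> dom \<Longrightarrow> x \<in> K \<Longrightarrow> y \<in> K \<Longrightarrow> \<bar>u x - u y\<bar> \<le> C * sqrt (\<E> u u)"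
    using oscillation by blast
  have d: "?d m n \<in> dom" for m n by (intro diff_mem s)
  have "uniformly_Cauchy_on K s"
  proof (rule uniformly_Cauchy_onI)
    fix \<epsilon> :: real assume "\<epsilon> > 0"
    define \<eta> where "\<eta> = (\<epsilon> / (2 * C))\<^sup>2"
    have "\<eta> > 0" using \<open>\<epsilon> > 0\<close> C(1) by (simp add: \<eta>_def)
    then obtain N where N: "\<And>m n. m \<ge> N \<Longrightarrow> n \<ge> N \<Longrightarrow> \<E> (?d m n) (?d m n) \<le> \<eta>"
      using cauchy by meson
    have "dist (s m x) (s n x) < \<epsilon>" if "x \<in> K" "m \<ge> N" "n \<ge> N" for x m n
    proof -
      have "\<bar>?d m n x - ?d m n e\<bar> \<le> C * sqrt (\<E> (?d m n) (?d m n))"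
        by (rule C(2)[OF d that(1) e])
      also have "\<dots> \<le> C * sqrt \<eta>"
        using N[OF that(2,3)] C(1) by (intro mult_left_mono real_sqrt_le_mono) auto
      also have "\<dots> = \<epsilon> / 2" using C(1) \<open>\<epsilon> > 0\<close> by (simp add: \<eta>_def)
      finally show ?thesis using \<open>\<epsilon> > 0\<close> by (simp add: s(2) dist_real_def)
    qed
    then show "\<exists>M. \<forall>x\<in>K. \<forall>m\<ge>M. \<forall>n\<ge>M. dist (s m x) (s n x) < \<epsilon>" by blast
  qed
  then obtain u where u: "uniform_limit K s u sequentially"
    using uniformly_convergent_eq_Cauchy uniformly_convergent_on_def by blast
  have cont: "continuous_on K u"
    using dom_continuous[OF s(1)] by (intro uniform_limit_theorem[OF _ u] eventuallyI) auto
  have lim: "(\<lambda>n. s n x) \<longlonglongrightarrow> u x" if "x \<in> K" for x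
    by (rule tendsto_uniform_limitI[OF u that])
  have lim_level: "(\<lambda>m. level k (?d n m) (?d n m)) \<longlonglongrightarrow> level k (\<lambda>x. s n x - u x) (\<lambda>x. s n x - u x)"
    for k n
    unfolding level_eq boundary_energy_def comp_def
    using boundary_subset word_mem by (intro tendsto_intros lim) auto
  have bounded: "\<exists>N. \<forall>n\<ge>N. bounded_energy \<epsilon> (\<lambda>x. s n x - u x)" if "\<epsilon> > 0" for \<epsilon>
  proof -
    obtain N where N: "\<And>m n. m \<ge> N \<Longrightarrow> n \<ge> N \<Longrightarrow> \<E> (?d m n) (?d m n) \<le> \<epsilon>"
      using cauchy \<open>\<epsilon> > 0\<close> by meson
    have "level k (\<lambda>x. s n x - u x) (\<lambda>x. s n x - u x) \<le> \<epsilon>" if "n \<ge> N" for n k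
    proof (rule LIMSEQ_le_const2[OF lim_level])
      have "level k (?d n m) (?d n m) \<le> \<epsilon>" if "m \<ge> N" for m
        using dom_bounded_energy[OF d[of n m]] N[OF \<open>n \<ge> N\<close> that]
        unfolding bounded_energy_def by (meson order_trans)
      then show "\<exists>M. \<forall>m\<ge>M. level k (?d n m) (?d n m) \<le> \<epsilon>" by blast
    qed
    then show ?thesis unfolding bounded_energy_def by blast
  qed
  have dom_diff: "(\<lambda>x. s n x - u x) \<in> dom" if "bounded_energy \<epsilon> (\<lambda>x. s n x - u x)" for n \<epsilon>
    using domI[OF continuous_on_diff[OF dom_continuous[OF s(1)] cont] that] .
  obtain n where n: "(\<lambda>x. s n x - u x) \<in> dom" using bounded[of 1] dom_diff by auto
  have u_dom: "u \<in> dom" using diff_mem[OF s(1)[of n] n] by simp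
  have "(\<lambda>n. \<E> (\<lambda>x. s n x - u x) (\<lambda>x. s n x - u x)) \<longlonglongrightarrow> 0"
  proof (rule LIMSEQ_I)
    fix \<epsilon> :: real assume "\<epsilon> > 0"
    then obtain N where N: "\<forall>n\<ge>N. bounded_energy (\<epsilon> / 2) (\<lambda>x. s n x - u x)"
      using bounded[of "\<epsilon> / 2"] by auto
    have "norm (\<E> (\<lambda>x. s n x - u x) (\<lambda>x. s n x - u x) - 0) < \<epsilon>" if "n \<ge> N" for n
    proof -
      have "bounded_energy (\<epsilon> / 2) (\<lambda>x. s n x - u x)" using N that by blast
      then show ?thesis
        using energy_le[OF dom_diff] nonneg[OF dom_diff] \<open>\<epsilon> > 0\<close> by fastforce
    qed
    then show "\<exists>N. \<forall>n\<ge>N. norm (\<E> (\<lambda>x. s n x - u x) (\<lambda>x. s n x - u x) - 0) < \<epsilon>" by blast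
  qed
  with u_dom lim that show thesis by blast
qed

section \<open>Harmonic extension and separation of points\<close>

text \<open>Functions chosen cell by cell fit together when each has the values of \<open>u\<close> on the boundary of its
  cell, as cells of one level overlap only there.\<close>

lemma glue:
  assumes "\<And>w. length w = m \<Longrightarrow> \<forall>p\<in>V\<^sub>0. g w p = u (foldr F w p)"
  obtains v where "\<And>w z. length w = m \<Longrightarrow> z \<in> K \<Longrightarrow> v (foldr F w z) = (g w z :: real)"
proof -
  define W where "W x = (SOME w. length w = m \<and> x \<in> foldr F w ` K)" for x
  define v where "v x = g (W x) (inv (foldr F (W x)) x)" for x
  have "v (foldr F w z) = g w z" if "length w = m" "z \<in> K" for w z
  proof -
    let ?x = "foldr F w z"
    have "\<exists>w. length w = m \<and> ?x \<in> foldr F w ` K" using that by blast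
    then have "length (W ?x) = m \<and> ?x \<in> foldr F (W ?x) ` K"
      unfolding W_def by (rule someI_ex)
    then obtain y where W: "length (W ?x) = m" "y \<in> K" "?x = foldr F (W ?x) y" by blast
    have "inv (foldr F (W ?x)) ?x = y"
      by (subst W(3)) (simp add: inv_f_f inj_def word_inj)
    then have v: "v ?x = g (W ?x) y" by (simp add: v_def)
    show ?thesis
    proof (cases "W ?x = w")
      case True
      then show ?thesis using v W(3) word_inj by simp
    next
      case False
      have "y \<in> V\<^sub>0" "z \<in> V\<^sub>0"
        using words_meet_in_boundary[of "W ?x" w y z] words_meet_in_boundary[of w "W ?x" z y]
          W that False by auto
      then have "g (W ?x) y = u ?x" "g w z = u ?x" using assms W that by auto
      then show ?thesis using v by simp
    qed
  qed
  then show thesis by (rule that)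
qed

lemma extend_one_level:
  obtains v where "\<And>x. x \<in> vertices m \<Longrightarrow> v x = u x" "level (Suc m) v v = level m u u"
proof -
  have "\<exists>v. (\<forall>p\<in>V\<^sub>0. v p = u (foldr F w p)) \<and> level 1 v v = \<E>\<^sub>0 (u \<circ> foldr F w) (u \<circ> foldr F w)" for w
    using minimal_extension[of "u \<circ> foldr F w"] by simp
  then obtain g where g: "\<And>w. \<forall>p\<in>V\<^sub>0. g w p = u (foldr F w p)"
      "\<And>w. level 1 (g w) (g w) = \<E>\<^sub>0 (u \<circ> foldr F w) (u \<circ> foldr F w)"
    by metis
  obtain v where v: "\<And>w z. length w = m \<Longrightarrow> z \<in> K \<Longrightarrow> v (foldr F w z) = g w z"
    using glue[of m g u] g(1) by blast
  have "v x = u x" if "x \<in> vertices m" for x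
  proof -
    obtain w p where "length w = m" "p \<in> V\<^sub>0" "x = foldr F w p"
      using \<open>x \<in> vertices m\<close> by (auto simp: vertices_def)
    then show ?thesis using v[of w p] g(1)[of w] boundary_subset by auto
  qed
  moreover have "level (m + 1) v v = level m u u"
    unfolding level_add level_eq[of m]
  proof (intro sum.cong refl arg_cong2[where f = "(*)"])
    fix w :: "'i list" assume "w \<in> {w. length w = m}"
    then have "level 1 (v \<circ> foldr F w) (v \<circ> foldr F w) = level 1 (g w) (g w)"
      using v vertices_subset by (intro level_cong) auto
    then show "level 1 (v \<circ> foldr F w) (v \<circ> foldr F w) = \<E>\<^sub>0 (u \<circ> foldr F w) (u \<circ> foldr F w)"
      by (simp only: g(2))
  qed
  ultimately show thesis by (intro that) auto
qed

text \<open>Energy-minimizing extensions from each level to the next define a function on all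
  vertices without adding energy.  Its energy being bounded, it is uniformly continuous there and
  extends to the closure \<open>K\<close>.\<close>

lemma harmonic_extension:
  obtains g where "g \<in> dom" "\<And>x. x \<in> vertices m \<Longrightarrow> g x = u x"
    "\<And>n. level (m + n) g g = level m u u"
proof -
  let ?P = "\<lambda>n f. case n of 0 \<Rightarrow> f = u | Suc _ \<Rightarrow> True"
  let ?Q = "\<lambda>n f v. (\<forall>x\<in>vertices (m + n). v x = f x) \<and>
       level (m + Suc n) v v = level (m + n) f f"
  have "\<exists>f. \<forall>n. ?P n (f n) \<and> ?Q n (f n) (f (Suc n))"
  proof (rule dependent_nat_choice)
    fix f :: "'a \<Rightarrow> real" and n :: nat
    obtain v where v: "\<And>x. x \<in> vertices (m + n) \<Longrightarrow> v x = f x"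
        "level (Suc (m + n)) v v = level (m + n) f f"
      using extend_one_level[of "m + n" f] by blast
    show "\<exists>v. ?P (Suc n) v \<and> ?Q n f v"
      by (rule exI[of _ v]) (use v in simp)
  qed simp
  then obtain f where P: "\<And>n. ?P n (f n)" and Q: "\<And>n. ?Q n (f n) (f (Suc n))" by blast
  have f0: "f 0 = u" using P[of 0] by simp
  have f: "\<And>n x. x \<in> vertices (m + n) \<Longrightarrow> f (Suc n) x = f n x"
      "\<And>n. level (m + Suc n) (f (Suc n)) (f (Suc n)) = level (m + n) (f n) (f n)"
    using Q by blast+
  have f_level: "level (m + n) (f n) (f n) = level m u u" for n
    by (induction n) (simp_all add: f0 f(2)[simplified])
  have f_stable: "f (n + k) x = f n x" if "x \<in> vertices (m + n)" for n k x
  proof (induction k)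
    case (Suc k)
    have "x \<in> vertices (m + (n + k))" using that vertices_mono[of "m + n" "m + (n + k)"] by auto
    then show ?case using f(1)[of x "n + k"] Suc.IH by simp
  qed simp
  define h where "h x = f (LEAST n. x \<in> vertices (m + n)) x" for x
  have h: "h x = f n x" if "x \<in> vertices (m + n)" for n x
  proof -
    let ?l = "LEAST n. x \<in> vertices (m + n)"
    have "x \<in> vertices (m + ?l)" using that by (rule LeastI)
    moreover have "?l \<le> n" using that by (rule Least_le)
    ultimately show ?thesis using f_stable[of x ?l "n - ?l"] by (simp add: h_def)
  qed
  have h_level: "level (m + n) h h = level m u u" for n
    using level_cong[of "m + n" h "f n" h "f n"] h f_level by simp
  have h_bounded: "bounded_energy (level m u u) h"
    unfolding bounded_energy_def using level_mono[of _ "m + _" h] h_level le_add2 by metis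
  have "uniformly_continuous_on all_vertices h"
    unfolding uniformly_continuous_on_def
  proof (intro allI impI)
    fix \<epsilon> :: real assume "\<epsilon> > 0"
    define \<eta> where "\<eta> = \<epsilon> / (sqrt (level m u u) + 1)"
    have pos: "sqrt (level m u u) + 1 > 0" using level_nonneg[of m u] by (simp add: add_nonneg_pos)
    then have "\<eta> > 0" using \<open>\<epsilon> > 0\<close> by (simp add: \<eta>_def)
    then obtain \<delta> where \<delta>: "0 < \<delta>" "\<And>u M x y. bounded_energy M u \<Longrightarrow> x \<in> all_vertices \<Longrightarrow>
        y \<in> all_vertices \<Longrightarrow> dist x y < \<delta> \<Longrightarrow> \<bar>u x - u y\<bar> \<le> \<eta> * sqrt M"
      using equicontinuous_all_vertices by blast
    have "\<eta> * sqrt (level m u u) < \<eta> * (sqrt (level m u u) + 1)" using \<open>\<eta> > 0\<close> by simp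
    also have "\<dots> = \<epsilon>" using pos by (simp add: \<eta>_def)
    finally have "\<eta> * sqrt (level m u u) < \<epsilon>" .
    then have "\<forall>x\<in>all_vertices. \<forall>x'\<in>all_vertices. dist x' x < \<delta> \<longrightarrow> dist (h x') (h x) < \<epsilon>"
      using \<delta>(2)[OF h_bounded] by (fastforce simp: dist_real_def)
    then show "\<exists>d>0. \<forall>x\<in>all_vertices. \<forall>x'\<in>all_vertices. dist x' x < d \<longrightarrow> dist (h x') (h x) < \<epsilon>"
      using \<delta>(1) by blast
  qed
  then obtain g where g: "uniformly_continuous_on (closure all_vertices) g"
      "\<And>x. x \<in> all_vertices \<Longrightarrow> h x = g x"
    by (rule uniformly_continuous_on_extension_on_closure) blast
  have gh: "g x = h x" if "x \<in> vertices n" for x n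
  proof -
    have "x \<in> all_vertices" using that unfolding all_vertices_def by blast
    then show ?thesis using g(2) by simp
  qed
  have g_level: "level n g g = level n h h" for n
    using gh by (intro level_cong) auto
  have "g \<in> dom"
  proof (rule domI)
    show "continuous_on K g"
      using g(1) dense_vertices[OF V0_ne] uniformly_continuous_imp_continuous by metis
    show "bounded_energy (level m u u) g"
      using h_bounded by (simp add: bounded_energy_def g_level)
  qed
  moreover have "g x = u x" if "x \<in> vertices m" for x
    using gh[OF that] h[of x 0] that f0 by simp
  moreover have "level (m + n) g g = level m u u" for n
    by (simp add: g_level h_level)
  ultimately show thesis by (rule that)
qed

text \<open>The energy of \<open>g\<close> at levels \<open>m\<close> and \<open>m + n\<close> is a sum over the cells \<open>w\<close> of contributions that do not
  decrease with the level.  The totals agree, so the contribution of each single cell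
  stays the same.  Where \<open>g\<close> is constant on the boundary of a cell it is zero at level \<open>m\<close>, hence
  at all levels.\<close>

lemma extension_constant_on_cells:
  assumes g: "g \<in> dom" and min: "\<And>n. level (m + n) g g = level m g g"
    and w: "length w = m" and const: "\<And>p. p \<in> V\<^sub>0 \<Longrightarrow> g (foldr F w p) = a" and z: "z \<in> K"
  shows "g (foldr F w z) = a"
proof -
  let ?g = "g \<circ> foldr F w"
  have "level n ?g ?g = 0" for n
  proof -
    have "inverse (weight w) * level 0 ?g ?g = inverse (weight w) * level n ?g ?g"
    proof (rule sum_mono_inv[where I = "{w. length w = m}"
          and f = "\<lambda>w. inverse (weight w) * level 0 (g \<circ> foldr F w) (g \<circ> foldr F w)"
          and g = "\<lambda>w. inverse (weight w) * level n (g \<circ> foldr F w) (g \<circ> foldr F w)"])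
      show "(\<Sum>w | length w = m. inverse (weight w) * level 0 (g \<circ> foldr F w) (g \<circ> foldr F w))
          = (\<Sum>w | length w = m. inverse (weight w) * level n (g \<circ> foldr F w) (g \<circ> foldr F w))"
        using min[of 0] min[of n] by (simp only: level_add[symmetric])
      show "inverse (weight w) * level 0 (g \<circ> foldr F w) (g \<circ> foldr F w)
          \<le> inverse (weight w) * level n (g \<circ> foldr F w) (g \<circ> foldr F w)" for w
        using weight_pos[of w] by (intro mult_left_mono level_mono) (auto simp: less_imp_le)
    qed (use w finite_words in auto)
    moreover have "level 0 ?g ?g = \<E>\<^sub>0 (\<lambda>_. a) (\<lambda>_. a)"
      unfolding level_0 using const by (intro boundary_energy_cong) auto
    moreover have "\<E>\<^sub>0 (\<lambda>_. a) (\<lambda>_. a) = 0" by (simp add: boundary_energy_def)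
    ultimately show ?thesis using weight_pos[of w] by simp
  qed
  then have zero: "\<E> ?g ?g = 0" by (simp add: energy_def)
  obtain p where p: "p \<in> V\<^sub>0" using V0_ne by blast
  then have "p \<in> K" using boundary_subset by blast
  obtain C where C: "0 < C"
      "\<And>u x y. u \<in> dom \<Longrightarrow> x \<in> K \<Longrightarrow> y \<in> K \<Longrightarrow> \<bar>u x - u y\<bar> \<le> C * sqrt (\<E> u u)"
    using oscillation by blast
  \<comment> \<open>A function of energy zero has no oscillation.\<close>
  have "\<bar>?g z - ?g p\<bar> \<le> 0"
    using C(2)[OF dom_word[OF g] z \<open>p \<in> K\<close>, of w] zero by simp
  then show ?thesis using const[OF p] by simp
qed

lemma separating_function:
  assumes "finite E" "E \<subseteq> K" "x \<in> E"
  obtains g where "g \<in> dom" "g x = 1" "\<And>y. y \<in> E \<Longrightarrow> y \<noteq> x \<Longrightarrow> g y = 0"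
proof -
  obtain d where d: "d > 0" "\<And>y. y \<in> E \<Longrightarrow> y \<noteq> x \<Longrightarrow> d \<le> dist x y"
    using finite_set_avoid[OF assms(1), of x] by blast
  obtain s where s: "0 < s" "s < 1"
      "\<And>w x y. dist (foldr F w x) (foldr F w y) \<le> s ^ length w * dist x y"
    using contraction by blast
  have "(\<lambda>m. s ^ m * diameter K) \<longlonglongrightarrow> 0 * diameter K"
    using s by (intro tendsto_mult LIMSEQ_power_zero tendsto_const) auto
  then have "\<forall>\<^sub>F m in sequentially. s ^ m * diameter K < d / 2"
    by (rule order_tendstoD(2)) (use d in simp)
  then obtain m where m: "s ^ m * diameter K < d / 2" by (auto simp: eventually_sequentially)
  have small: "dist a b < d / 2" if "length w = m" "a \<in> foldr F w ` K" "b \<in> foldr F w ` K" for w a b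
  proof -
    obtain a' b' where ab: "a' \<in> K" "b' \<in> K" "a = foldr F w a'" "b = foldr F w b'"
      using \<open>a \<in> foldr F w ` K\<close> \<open>b \<in> foldr F w ` K\<close> by blast
    have "dist a b \<le> s ^ m * dist a' b'" using s(3)[of w a' b'] ab \<open>length w = m\<close> by simp
    also have "\<dots> \<le> s ^ m * diameter K"
      using diameter_bounded_bound[of K a' b'] compact_K ab s
      by (intro mult_left_mono) (auto simp: compact_imp_bounded)
    finally show ?thesis using m by simp
  qed
  \<comment> \<open>Marks the union of the cells around \<open>x\<close>; no cell of level \<open>m\<close> that meets it contains another point of \<open>E\<close>.\<close>
  define u :: "'a \<Rightarrow> real" where "u z = of_bool (\<exists>w. length w = m \<and> x \<in> foldr F w ` K \<and> z \<in> foldr F w ` K)" for z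
  obtain g where g: "g \<in> dom" "\<And>x. x \<in> vertices m \<Longrightarrow> g x = u x" "\<And>n. level (m + n) g g = level m u u"
    using harmonic_extension[of m u] by blast
  have min: "level (m + n) g g = level m g g" for n
    using g(3)[of n] g(3)[of 0] by simp
  have on_cell: "g (foldr F w z) = a"
    if "length w = m" "z \<in> K" "\<And>p. p \<in> V\<^sub>0 \<Longrightarrow> u (foldr F w p) = a" for w z a
  proof (rule extension_constant_on_cells[OF g(1) min that(1) _ that(2)])
    fix p assume "p \<in> V\<^sub>0"
    then show "g (foldr F w p) = a"
      using that g(2)[of "foldr F w p"] by (auto simp: vertices_def)
  qed
  have "x \<in> K" using assms by blast
  then obtain w a where w: "length w = m" "a \<in> K" "x = foldr F w a" using word_cover by blast
  have "g (foldr F w a) = 1"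
  proof (rule on_cell[OF w(1,2)])
    fix p assume "p \<in> V\<^sub>0"
    then have "p \<in> K" using boundary_subset by blast
    then show "u (foldr F w p) = 1" unfolding u_def using w by auto
  qed
  moreover have "g y = 0" if y: "y \<in> E" "y \<noteq> x" for y
  proof -
    have "y \<in> K" using assms y by blast
    then obtain w' b where w': "length w' = m" "b \<in> K" "y = foldr F w' b" using word_cover by blast
    have "g (foldr F w' b) = 0"
    proof (rule on_cell[OF w'(1,2)])
      fix p assume p: "p \<in> V\<^sub>0"
      show "u (foldr F w' p) = 0"
      proof (rule ccontr)
        assume "u (foldr F w' p) \<noteq> 0"
        then obtain t where t: "length t = m" "x \<in> foldr F t ` K" "foldr F w' p \<in> foldr F t ` K"
          by (auto simp: u_def)
        have "foldr F w' p \<in> foldr F w' ` K" "y \<in> foldr F w' ` K"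
          using p boundary_subset w' by auto
        then have "dist x (foldr F w' p) < d / 2" "dist (foldr F w' p) y < d / 2"
          using small[OF t] small[OF w'(1)] by auto
        then have "dist x y < d" using dist_triangle_half_r by (metis dist_commute)
        then show False using d(2)[OF y] by simp
      qed
    qed
    then show ?thesis using w' by simp
  qed
  ultimately show thesis using g(1) w(3) by (intro that[of g]) auto
qed

end

section \<open>Functions vanishing on the nodes\<close>

locale harmonic_quadrature = harmonic_structure K F r c
  for K :: "'a::euclidean_space set" and F :: "'i::finite \<Rightarrow> 'a \<Rightarrow> 'a"
    and r :: "'i \<Rightarrow> real" and c :: "'a \<Rightarrow> 'a \<Rightarrow> real" +
  fixes \<mu> :: "'a measure" and E :: "'a set"
  assumes admissible: "admissible_measure K \<mu>"
    and finite_E: "finite E" and E_ne: "E \<noteq> {}" and E_subset: "E \<subseteq> K"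
begin

definition dom\<^sub>0 :: "('a \<Rightarrow> real) set" where
  "dom\<^sub>0 = {u \<in> dom. \<forall>x\<in>E. u x = 0}"

sublocale dirichlet: form_space dom\<^sub>0 \<E>
  by standard (auto simp: dom\<^sub>0_def zero_mem lin_mem lin nonneg intro: commute)

text \<open>Compare with the value at a node.\<close>

lemma dom0_bound:
  obtains C where "0 < C" "\<And>u x. u \<in> dom\<^sub>0 \<Longrightarrow> x \<in> K \<Longrightarrow> \<bar>u x\<bar> \<le> C * sqrt (\<E> u u)"
proof -
  obtain e where e: "e \<in> E" "e \<in> K" using E_ne E_subset by blast
  obtain C where C: "0 < C"
      "\<And>u x y. u \<in> dom \<Longrightarrow> x \<in> K \<Longrightarrow> y \<in> K \<Longrightarrow> \<bar>u x - u y\<bar> \<le> C * sqrt (\<E> u u)"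
    using oscillation by blast
  have "\<bar>u x\<bar> \<le> C * sqrt (\<E> u u)" if "u \<in> dom\<^sub>0" "x \<in> K" for u x
    using C(2)[of u x e] e that by (simp add: dom\<^sub>0_def)
  with C(1) that show thesis by blast
qed

lemma dom0_riesz:
  assumes "\<And>u v a. u \<in> dom\<^sub>0 \<Longrightarrow> v \<in> dom\<^sub>0 \<Longrightarrow> l (\<lambda>x. u x + a * v x) = l u + a * l v"
    and "\<And>v. v \<in> dom\<^sub>0 \<Longrightarrow> \<bar>l v\<bar> \<le> C * sqrt (\<E> v v)"
  obtains h where "h \<in> dom\<^sub>0" "\<And>v. v \<in> dom\<^sub>0 \<Longrightarrow> \<E> h v = l v"
proof -
  obtain e where e: "e \<in> E" "e \<in> K" using E_ne E_subset by blast
  have "\<exists>h\<in>dom\<^sub>0. \<forall>v\<in>dom\<^sub>0. \<E> h v = l v"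
  proof (rule dirichlet.riesz[OF _ assms])
    fix s assume s: "\<And>n :: nat. s n \<in> dom\<^sub>0"
      and cauchy: "\<And>\<epsilon>. \<epsilon> > 0 \<Longrightarrow>
        \<exists>N. \<forall>m\<ge>N. \<forall>n\<ge>N. \<E> (\<lambda>x. s m x - s n x) (\<lambda>x. s m x - s n x) \<le> \<epsilon>"
    have s': "\<And>n. s n \<in> dom" "\<And>n x. x \<in> E \<Longrightarrow> s n x = 0" using s by (auto simp: dom\<^sub>0_def)
    obtain u where u: "u \<in> dom" "\<And>x. x \<in> K \<Longrightarrow> (\<lambda>n. s n x) \<longlonglongrightarrow> u x"
        "(\<lambda>n. \<E> (\<lambda>x. s n x - u x) (\<lambda>x. s n x - u x)) \<longlonglongrightarrow> 0"
      using complete_vanishing[OF e(2) s'(1) s'(2)[OF e(1)] cauchy] by blast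
    have "u x = 0" if "x \<in> E" for x
    proof -
      have "(\<lambda>n. s n x) \<longlonglongrightarrow> u x" using u(2) that E_subset by blast
      then have "(\<lambda>n :: nat. 0 :: real) \<longlonglongrightarrow> u x" using s'(2)[OF that] by simp
      then show ?thesis using LIMSEQ_unique tendsto_const by blast
    qed
    then have "u \<in> dom\<^sub>0" using u(1) by (simp add: dom\<^sub>0_def)
    with u(3) show "\<exists>u\<in>dom\<^sub>0. (\<lambda>n. \<E> (\<lambda>x. s n x - u x) (\<lambda>x. s n x - u x)) \<longlonglongrightarrow> 0" by blast
  qed auto
  then show thesis using that by blast
qed

section \<open>Integration of functions of finite energy\<close>

lemma space_mu: "space \<mu> = K"
  using admissible sets_eq_imp_space_eq[of \<mu> "restrict_space borel K"]
  by (simp add: admissible_measure_def space_restrict_space)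

sublocale prob_space \<mu>
  using admissible by (simp add: admissible_measure_def)

lemma dom_measurable: "u \<in> dom \<Longrightarrow> u \<in> borel_measurable \<mu>"
  using borel_measurable_continuous_on_restrict[OF dom_continuous] admissible
  by (simp add: admissible_measure_def cong: measurable_cong_sets)

lemma dom_bounded:
  assumes "u \<in> dom"
  obtains B where "\<And>x. x \<in> K \<Longrightarrow> \<bar>u x\<bar> \<le> B"
proof -
  have "bounded (u ` K)"
    using compact_continuous_image[OF dom_continuous[OF assms] compact_K] by (rule compact_imp_bounded)
  then obtain B where "\<forall>y\<in>u ` K. norm y \<le> B" unfolding bounded_iff by blast
  then show thesis by (intro that[of B]) simp
qed

lemma integrable_mult_dom:
  assumes "u \<in> dom" "integrable \<mu> f"
  shows "integrable \<mu> (\<lambda>x. u x * f x)"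
proof -
  obtain B where B: "\<And>x. x \<in> K \<Longrightarrow> \<bar>u x\<bar> \<le> B" using dom_bounded[OF assms(1)] by blast
  show ?thesis
  proof (rule Bochner_Integration.integrable_bound[of \<mu> "\<lambda>x. B * f x"])
    show "integrable \<mu> (\<lambda>x. B * f x)" using assms(2) by simp
    show "(\<lambda>x. u x * f x) \<in> borel_measurable \<mu>"
      using dom_measurable[OF assms(1)] assms(2) by measurable
    show "AE x in \<mu>. norm (u x * f x) \<le> norm (B * f x)"
    proof (rule AE_I2)
      fix x assume "x \<in> space \<mu>"
      then have "\<bar>u x\<bar> \<le> \<bar>B\<bar>" using B[of x] by (simp add: space_mu)
      then show "norm (u x * f x) \<le> norm (B * f x)"
        by (simp add: abs_mult mult_right_mono)
    qed
  qed
qed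

lemma integrable_dom: "u \<in> dom \<Longrightarrow> integrable \<mu> u"
  using integrable_mult_dom[of u "\<lambda>_. 1"] by simp

lemma integral_mult_bound:
  assumes "u \<in> dom" "integrable \<mu> f" "\<And>x. x \<in> K \<Longrightarrow> \<bar>u x\<bar> \<le> B"
  shows "\<bar>\<integral>x. u x * f x \<partial>\<mu>\<bar> \<le> B * (\<integral>x. \<bar>f x\<bar> \<partial>\<mu>)"
proof -
  have "\<bar>\<integral>x. u x * f x \<partial>\<mu>\<bar> \<le> (\<integral>x. \<bar>u x * f x\<bar> \<partial>\<mu>)" by (rule integral_abs_bound)
  also have "\<dots> \<le> (\<integral>x. B * \<bar>f x\<bar> \<partial>\<mu>)"
  proof (rule integral_mono)
    show "integrable \<mu> (\<lambda>x. \<bar>u x * f x\<bar>)"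
      by (intro integrable_abs integrable_mult_dom assms)
    show "integrable \<mu> (\<lambda>x. B * \<bar>f x\<bar>)"
      by (intro integrable_mult_right integrable_abs assms)
    show "\<bar>u x * f x\<bar> \<le> B * \<bar>f x\<bar>" if "x \<in> space \<mu>" for x
      using assms(3)[of x] that by (simp add: space_mu abs_mult mult_right_mono)
  qed
  finally show ?thesis by simp
qed

section \<open>Green's function\<close>

lemma weak_solution:
  assumes f: "integrable \<mu> f"
  obtains h where "h \<in> dom\<^sub>0" "\<And>v. v \<in> dom\<^sub>0 \<Longrightarrow> \<E> h v = (\<integral>x. f x * v x \<partial>\<mu>)"
proof -
  obtain C where C: "0 < C" "\<And>u x. u \<in> dom\<^sub>0 \<Longrightarrow> x \<in> K \<Longrightarrow> \<bar>u x\<bar> \<le> C * sqrt (\<E> u u)"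
    using dom0_bound by blast
  have dom: "v \<in> dom" if "v \<in> dom\<^sub>0" for v using that by (simp add: dom\<^sub>0_def)
  show thesis
  proof (rule dom0_riesz[of "\<lambda>v. \<integral>x. f x * v x \<partial>\<mu>" "C * (\<integral>x. \<bar>f x\<bar> \<partial>\<mu>)"])
    fix u v a assume u: "u \<in> dom\<^sub>0" and v: "v \<in> dom\<^sub>0"
    have "(\<integral>x. f x * (u x + a * v x) \<partial>\<mu>) = (\<integral>x. u x * f x + a * (v x * f x) \<partial>\<mu>)"
      by (simp add: algebra_simps)
    also have "\<dots> = (\<integral>x. u x * f x \<partial>\<mu>) + a * (\<integral>x. v x * f x \<partial>\<mu>)"
      using integrable_mult_dom[OF dom[OF u] f] integrable_mult_dom[OF dom[OF v] f] by simp
    finally show "(\<integral>x. f x * (u x + a * v x) \<partial>\<mu>) = (\<integral>x. f x * u x \<partial>\<mu>) + a * (\<integral>x. f x * v x \<partial>\<mu>)"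
      by (simp add: mult.commute)
    show "\<bar>\<integral>x. f x * v x \<partial>\<mu>\<bar> \<le> C * (\<integral>x. \<bar>f x\<bar> \<partial>\<mu>) * sqrt (\<E> v v)"
      using integral_mult_bound[OF dom[OF v] f C(2)[OF v]] by (simp add: mult_ac)
  qed (rule that)
qed

text \<open>\<open>G x\<close> represents evaluation at \<open>x\<close>.  Then \<open>G x y = \<E>(G x, G y)\<close> is symmetric, the energy of
  \<open>G x\<close> is bounded uniformly in \<open>x\<close>, and equicontinuity in each variable gives joint continuity.
  For the solution \<open>h\<close> with right-hand side \<open>f\<close>, obtained from Riesz representation, the
  integral formula is the equation of \<open>h\<close> tested against \<open>G x\<close>.\<close>

lemma green_exists: "\<exists>G. is_green K F r c \<mu> E G"
proof -
  obtain C where C: "0 < C" "\<And>u x. u \<in> dom\<^sub>0 \<Longrightarrow> x \<in> K \<Longrightarrow> \<bar>u x\<bar> \<le> C * sqrt (\<E> u u)"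
    using dom0_bound by blast
  have "\<exists>h. x \<in> K \<longrightarrow> h \<in> dom\<^sub>0 \<and> (\<forall>v\<in>dom\<^sub>0. \<E> h v = v x)" for x
  proof (cases "x \<in> K")
    case True
    show ?thesis
      by (rule dom0_riesz[of "\<lambda>v. v x" C]) (use C(2) True in auto)
  qed simp
  then obtain G where G: "\<And>x. x \<in> K \<Longrightarrow> G x \<in> dom\<^sub>0"
      "\<And>x v. x \<in> K \<Longrightarrow> v \<in> dom\<^sub>0 \<Longrightarrow> \<E> (G x) v = v x"
    by metis
  have G_dom: "G x \<in> dom" if "x \<in> K" for x using G(1)[OF that] by (simp add: dom\<^sub>0_def)
  have G_sym: "G x y = G y x" if "x \<in> K" "y \<in> K" for x y
    using G that dirichlet.commute[of "G x" "G y"] by simp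
  have G_energy: "sqrt (\<E> (G x) (G x)) \<le> C" if "x \<in> K" for x
  proof -
    define t where "t = sqrt (\<E> (G x) (G x))"
    have "t * t = G x x" using G that dirichlet.nonneg[of "G x"] by (simp add: t_def)
    also have "\<dots> \<le> C * t" using C(2)[OF G(1)[OF that] that] by (simp add: t_def)
    finally have "t * t \<le> C * t" .
    moreover have "0 \<le> t" using dirichlet.nonneg[OF G(1)[OF that]] by (simp add: t_def)
    ultimately have "t \<le> C" using C(1) by (cases "t = 0") (auto simp: mult_le_cancel_right)
    then show ?thesis by (simp add: t_def)
  qed
  have cont: "continuous_on (K \<times> K) (\<lambda>(x, y). G x y)"
    unfolding continuous_on_iff
  proof (intro ballI allI impI)
    fix z :: "'a \<times> 'a" and \<epsilon> :: real assume z: "z \<in> K \<times> K" and "\<epsilon> > 0"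
    define \<eta> where "\<eta> = \<epsilon> / (3 * C)"
    have "\<eta> > 0" using \<open>\<epsilon> > 0\<close> C(1) by (simp add: \<eta>_def)
    then obtain \<delta> where \<delta>: "0 < \<delta>" "\<And>u x y. u \<in> dom \<Longrightarrow> x \<in> K \<Longrightarrow> y \<in> K \<Longrightarrow> dist x y < \<delta> \<Longrightarrow>
        \<bar>u x - u y\<bar> \<le> \<eta> * sqrt (\<E> u u)"
      using equicontinuous by blast
    have close: "\<bar>G x y - G x y'\<bar> \<le> \<epsilon> / 3" if "x \<in> K" "y \<in> K" "y' \<in> K" "dist y y' < \<delta>" for x y y'
    proof -
      have "\<bar>G x y - G x y'\<bar> \<le> \<eta> * sqrt (\<E> (G x) (G x))"
        by (rule \<delta>(2)[OF G_dom that(2-4)]) (rule that(1))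
      also have "\<dots> \<le> \<eta> * C" using \<open>\<eta> > 0\<close> G_energy[OF that(1)] by (intro mult_left_mono) auto
      also have "\<dots> = \<epsilon> / 3" using C(1) by (simp add: \<eta>_def)
      finally show ?thesis .
    qed
    have "dist (case z' of (x, y) \<Rightarrow> G x y) (case z of (x, y) \<Rightarrow> G x y) < \<epsilon>"
      if z': "z' \<in> K \<times> K" and "dist z' z < \<delta>" for z'
    proof -
      obtain x y x' y' where zz: "z = (x, y)" "z' = (x', y')" by (metis surj_pair)
      have K: "x \<in> K" "y \<in> K" "x' \<in> K" "y' \<in> K" using z z' zz by auto
      have "dist x' x < \<delta>" "dist y' y < \<delta>"
        using \<open>dist z' z < \<delta>\<close> dist_fst_le[of z' z] dist_snd_le[of z' z] zz by auto
      then have "\<bar>G x' y' - G x' y\<bar> \<le> \<epsilon> / 3" "\<bar>G y x' - G y x\<bar> \<le> \<epsilon> / 3"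
        using close K by blast+
      moreover have "G y x' = G x' y" "G y x = G x y" using G_sym K by auto
      ultimately have "\<bar>G x' y' - G x y\<bar> < \<epsilon>" using \<open>\<epsilon> > 0\<close> by linarith
      then show ?thesis using zz by (simp add: dist_real_def)
    qed
    then show "\<exists>d>0. \<forall>z'\<in>K \<times> K. dist z' z < d \<longrightarrow>
        dist (case z' of (x, y) \<Rightarrow> G x y) (case z of (x, y) \<Rightarrow> G x y) < \<epsilon>"
      using \<delta>(1) by blast
  qed
  have "dirichlet_solution K F r c \<mu> E f (\<lambda>x. \<integral>y. G x y * f y \<partial>\<mu>)" (is "dirichlet_solution _ _ _ _ _ _ _ ?h")
    if f: "integrable \<mu> f" for f
  proof -
    obtain h where h: "h \<in> dom\<^sub>0" "\<And>v. v \<in> dom\<^sub>0 \<Longrightarrow> \<E> h v = (\<integral>x. f x * v x \<partial>\<mu>)"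
      using weak_solution[OF f] by blast
    have eq: "h x = ?h x" if "x \<in> K" for x
    proof -
      have "h x = \<E> (G x) h" using G(2)[OF that h(1)] by simp
      also have "\<dots> = \<E> h (G x)" using dirichlet.commute G(1)[OF that] h(1) by simp
      also have "\<dots> = ?h x" using h(2)[OF G(1)[OF that]] by (simp add: mult.commute)
      finally show ?thesis .
    qed
    have "?h \<in> dom" 
      by (rule dom_cong[OF eq]) (use h(1) in \<open>simp_all add: dom\<^sub>0_def\<close>)
    moreover have "?h x = 0" if "x \<in> E" for x
    proof -
      have "h x = 0" using h(1) that by (simp add: dom\<^sub>0_def)
      then show ?thesis using eq[of x] that E_subset by auto
    qed
    moreover have "\<E> ?h v = (\<integral>x. f x * v x \<partial>\<mu>)" if "v \<in> dom" "\<forall>x\<in>E. v x = 0" for v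
    proof -
      have "\<E> ?h v = \<E> h v" using eq by (intro energy_cong) simp_all
      then show ?thesis using h(2)[of v] that by (simp add: dom\<^sub>0_def)
    qed
    ultimately show ?thesis unfolding dirichlet_solution_def by blast
  qed
  then show ?thesis using cont G_sym unfolding is_green_def by blast
qed

abbreviation g\<^sub>E :: "'a \<Rightarrow> real" where "g\<^sub>E \<equiv> green_mean K F r c \<mu> E"

lemma green_mean_solution:
  shows green_mean_dom0: "g\<^sub>E \<in> dom\<^sub>0"
    and green_mean_energy: "v \<in> dom\<^sub>0 \<Longrightarrow> \<E> g\<^sub>E v = (\<integral>x. v x \<partial>\<mu>)"
proof -
  have "is_green K F r c \<mu> E (green K F r c \<mu> E)"
    unfolding green_def by (rule someI_ex[OF green_exists])
  then have "dirichlet_solution K F r c \<mu> E (\<lambda>_. 1) (\<lambda>x. \<integral>y. green K F r c \<mu> E x y * 1 \<partial>\<mu>)"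
    unfolding is_green_def by (blast intro: integrable_const)
  moreover have "(\<lambda>x. \<integral>y. green K F r c \<mu> E x y * 1 \<partial>\<mu>) = g\<^sub>E"
    by (simp add: green_mean_def fun_eq_iff)
  ultimately have "dirichlet_solution K F r c \<mu> E (\<lambda>_. 1) g\<^sub>E" by simp
  then show "g\<^sub>E \<in> dom\<^sub>0" "v \<in> dom\<^sub>0 \<Longrightarrow> \<E> g\<^sub>E v = (\<integral>x. v x \<partial>\<mu>)"
    by (simp_all add: dirichlet_solution_def dom\<^sub>0_def)
qed

text \<open>The Markov property, for the contraction \<open>t \<mapsto> \<bar>t\<bar>\<close>; it holds for each conductance separately.\<close>

lemma abs_dom:
  assumes "u \<in> dom"
  shows "(\<lambda>x. \<bar>u x\<bar>) \<in> dom" "\<E> (\<lambda>x. \<bar>u x\<bar>) (\<lambda>x. \<bar>u x\<bar>) \<le> \<E> u u"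
proof -
  have E0: "\<E>\<^sub>0 (\<lambda>x. \<bar>v x\<bar>) (\<lambda>x. \<bar>v x\<bar>) \<le> \<E>\<^sub>0 v v" for v
    unfolding boundary_energy_def
  proof (intro divide_right_mono sum_mono)
    fix x y assume "x \<in> V\<^sub>0" "y \<in> V\<^sub>0"
    have "(\<bar>v x\<bar> - \<bar>v y\<bar>)\<^sup>2 \<le> (v x - v y)\<^sup>2"
      using abs_triangle_ineq3[of "v x" "v y"] by (simp add: abs_le_square_iff[symmetric])
    then show "c x y * (\<bar>v x\<bar> - \<bar>v y\<bar>) * (\<bar>v x\<bar> - \<bar>v y\<bar>) \<le> c x y * (v x - v y) * (v x - v y)"
      using c_nonneg[OF \<open>x \<in> V\<^sub>0\<close> \<open>y \<in> V\<^sub>0\<close>]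
      by (simp add: mult.assoc power2_eq_square mult_left_mono)
  qed simp
  have "level m (\<lambda>x. \<bar>u x\<bar>) (\<lambda>x. \<bar>u x\<bar>) \<le> level m u u" for m
    unfolding level_eq
  proof (intro sum_mono mult_left_mono)
    fix w
    show "\<E>\<^sub>0 ((\<lambda>x. \<bar>u x\<bar>) \<circ> foldr F w) ((\<lambda>x. \<bar>u x\<bar>) \<circ> foldr F w) \<le> \<E>\<^sub>0 (u \<circ> foldr F w) (u \<circ> foldr F w)"
      using E0[of "u \<circ> foldr F w"] by (simp add: comp_def)
    show "0 \<le> inverse (weight w)" using weight_pos[of w] by simp
  qed
  then have bounded: "bounded_energy (\<E> u u) (\<lambda>x. \<bar>u x\<bar>)"
    using dom_bounded_energy[OF assms] unfolding bounded_energy_def by (meson order_trans)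
  show "(\<lambda>x. \<bar>u x\<bar>) \<in> dom"
    by (rule domI[OF continuous_on_rabs[OF dom_continuous[OF assms]] bounded])
  then show "\<E> (\<lambda>x. \<bar>u x\<bar>) (\<lambda>x. \<bar>u x\<bar>) \<le> \<E> u u" using bounded by (rule energy_le)
qed

text \<open>Both \<open>g\<^sub>E\<close> and \<open>\<bar>g\<^sub>E\<bar>\<close> minimize \<open>\<E>(v) - 2 \<integral> v d\<mu>\<close> over \<open>dom\<^sub>0\<close>, so the energy of their
  difference is zero.\<close>

lemma green_mean_nonneg:
  assumes "x \<in> K"
  shows "0 \<le> g\<^sub>E x"
proof -
  let ?a = "\<lambda>x. \<bar>g\<^sub>E x\<bar>"
  have g: "g\<^sub>E \<in> dom" using green_mean_dom0 by (simp add: dom\<^sub>0_def)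
  have a: "?a \<in> dom\<^sub>0" using green_mean_dom0 abs_dom(1)[OF g] by (simp add: dom\<^sub>0_def)
  have "\<E> (\<lambda>x. ?a x - g\<^sub>E x) (\<lambda>x. ?a x - g\<^sub>E x) = \<E> ?a ?a - 2 * \<E> g\<^sub>E ?a + \<E> g\<^sub>E g\<^sub>E"
    using dirichlet.quad_diff[OF a green_mean_dom0] dirichlet.commute[OF a green_mean_dom0] by simp
  also have "\<dots> \<le> 2 * \<E> g\<^sub>E g\<^sub>E - 2 * \<E> g\<^sub>E ?a" using abs_dom(2)[OF g] by simp
  also have "\<dots> = 2 * (\<integral>x. g\<^sub>E x \<partial>\<mu>) - 2 * (\<integral>x. ?a x \<partial>\<mu>)"
    using green_mean_energy green_mean_dom0 a by simp
  also have "\<dots> \<le> 0"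
    using integral_mono[of \<mu> g\<^sub>E ?a] integrable_dom[OF g] by simp
  finally have le: "\<E> (\<lambda>x. ?a x - g\<^sub>E x) (\<lambda>x. ?a x - g\<^sub>E x) \<le> 0" .
  have d: "(\<lambda>x. ?a x - g\<^sub>E x) \<in> dom\<^sub>0" by (rule dirichlet.diff_mem[OF a green_mean_dom0])
  obtain C where "\<And>u x. u \<in> dom\<^sub>0 \<Longrightarrow> x \<in> K \<Longrightarrow> \<bar>u x\<bar> \<le> C * sqrt (\<E> u u)"
    using dom0_bound by blast
  from this[OF d assms] have "\<bar>?a x - g\<^sub>E x\<bar> \<le> 0"
    using le dirichlet.nonneg[OF d] by simp
  then show ?thesis by linarith
qed

lemma green_mean_le:
  assumes "x \<in> K"
  shows "g\<^sub>E x \<le> \<delta>\<^sub>1 K F r c \<mu> E"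
proof -
  have "g\<^sub>E \<in> dom" using green_mean_dom0 by (simp add: dom\<^sub>0_def)
  then obtain B where "\<And>x. x \<in> K \<Longrightarrow> \<bar>g\<^sub>E x\<bar> \<le> B" using dom_bounded by blast
  then have "bdd_above (g\<^sub>E ` K)" by (intro bdd_aboveI2[of _ _ B]) (auto simp: abs_le_iff)
  then show ?thesis unfolding \<delta>\<^sub>1_def by (rule cSUP_upper[OF assms])
qed

section \<open>Splines and the quadrature error\<close>

text \<open>Subtract from a function with the right values on \<open>E\<close> its orthogonal projection to \<open>dom\<^sub>0\<close>.\<close>

lemma spline_basis:
  assumes x: "x \<in> E"
  shows "spline_basis K F r c E x \<in> splines K F r c E"
    and "y \<in> E \<Longrightarrow> spline_basis K F r c E x y = of_bool (y = x)"
proof -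
  obtain b where b: "b \<in> dom" "b x = 1" "\<And>y. y \<in> E \<Longrightarrow> y \<noteq> x \<Longrightarrow> b y = 0"
    using separating_function[OF finite_E E_subset x] by blast
  have dom: "v \<in> dom" if "v \<in> dom\<^sub>0" for v using that by (simp add: dom\<^sub>0_def)
  obtain h where h: "h \<in> dom\<^sub>0" "\<And>v. v \<in> dom\<^sub>0 \<Longrightarrow> \<E> h v = \<E> b v"
  proof (rule dom0_riesz[of "\<E> b" "sqrt (\<E> b b)"])
    show "\<E> b (\<lambda>x. u x + a * v x) = \<E> b u + a * \<E> b v" if "u \<in> dom\<^sub>0" "v \<in> dom\<^sub>0" for u v a
      using lin_right b(1) dom that by simp
    show "\<bar>\<E> b v\<bar> \<le> sqrt (\<E> b b) * sqrt (\<E> v v)" if "v \<in> dom\<^sub>0" for v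
      using cauchy_schwarz[OF b(1) dom[OF that]] .
  qed (rule that)
  let ?v = "\<lambda>y. b y - h y"
  have "?v \<in> splines K F r c E"
    unfolding splines_def
  proof (intro CollectI conjI ballI impI)
    show "?v \<in> dom" by (intro diff_mem b dom h)
    fix \<phi> assume \<phi>: "\<phi> \<in> dom" "\<forall>x\<in>E. \<phi> x = 0"
    then have "\<phi> \<in> dom\<^sub>0" by (simp add: dom\<^sub>0_def)
    then show "\<E> ?v \<phi> = 0"
      using diff_left[OF b(1) dom[OF h(1)] \<phi>(1)] h(2) by simp
  qed
  moreover have "?v x = 1" "\<forall>y\<in>E - {x}. ?v y = 0" using b h(1) x by (auto simp: dom\<^sub>0_def)
  ultimately have "\<exists>v. v \<in> splines K F r c E \<and> v x = 1 \<and> (\<forall>y\<in>E - {x}. v y = 0)" by blast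
  then have *: "spline_basis K F r c E x \<in> splines K F r c E \<and> spline_basis K F r c E x x = 1 \<and>
      (\<forall>y\<in>E - {x}. spline_basis K F r c E x y = 0)"
    unfolding spline_basis_def by (rule someI_ex)
  then show "spline_basis K F r c E x \<in> splines K F r c E" by blast
  show "y \<in> E \<Longrightarrow> spline_basis K F r c E x y = of_bool (y = x)"
    using * by (cases "y = x") auto
qed

lemma spline_lin:
  assumes "u \<in> splines K F r c E" "v \<in> splines K F r c E"
  shows "(\<lambda>x. u x + a * v x) \<in> splines K F r c E"
  using assms by (simp add: splines_def lin_mem lin)

lemma spline_sum:
  assumes "finite A" "A \<subseteq> E"
  shows "(\<lambda>y. \<Sum>x\<in>A. u x * spline_basis K F r c E x y) \<in> splines K F r c E"
  using assms
proof (induction A rule: finite_induct)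
  case empty
  then show ?case by (simp add: splines_def zero_mem zero_left)
next
  case (insert x A)
  then have "(\<lambda>y. (\<Sum>x\<in>A. u x * spline_basis K F r c E x y) + u x * spline_basis K F r c E x y)
      \<in> splines K F r c E"
    by (intro spline_lin spline_basis) auto
  then show ?case using insert by (simp add: add.commute)
qed

text \<open>The error is the energy product of \<open>u\<close> with the mean of the Green's function: it vanishes on
  splines, and on functions vanishing on \<open>E\<close> it is the equation that \<open>g\<^sub>E\<close> solves.\<close>

lemma quadrature_error:
  assumes u: "u \<in> dom"
  shows "(\<integral>x. u x \<partial>\<mu>) - (\<Sum>x\<in>E. spline_weight K F r c \<mu> E x * u x) = \<E> g\<^sub>E u"
proof -
  define s where "s y = (\<Sum>x\<in>E. u x * spline_basis K F r c E x y)" for y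
  have s_spline: "s \<in> splines K F r c E"
    unfolding s_def using spline_sum[OF finite_E order_refl] .
  then have s: "s \<in> dom" by (simp add: splines_def)
  have basis: "integrable \<mu> (spline_basis K F r c E x)" if "x \<in> E" for x
    using spline_basis(1)[OF that] integrable_dom by (simp add: splines_def)
  have "s y = u y" if y: "y \<in> E" for y
  proof -
    have "s y = (\<Sum>x\<in>E. if x = y then u x else 0)"
      unfolding s_def using spline_basis(2)[OF _ y] by (intro sum.cong) auto
    then show ?thesis using finite_E y by simp
  qed
  then have d: "(\<lambda>x. u x - s x) \<in> dom\<^sub>0" using diff_mem[OF u s] by (simp add: dom\<^sub>0_def)
  have g: "g\<^sub>E \<in> dom" using green_mean_dom0 by (simp add: dom\<^sub>0_def)
  have "(\<integral>y. s y \<partial>\<mu>) = (\<Sum>x\<in>E. spline_weight K F r c \<mu> E x * u x)"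
    unfolding s_def spline_weight_def using basis by (simp add: mult.commute)
  then have "(\<integral>x. u x \<partial>\<mu>) - (\<Sum>x\<in>E. spline_weight K F r c \<mu> E x * u x)
      = (\<integral>x. u x - s x \<partial>\<mu>)"
    using integrable_dom[OF u] integrable_dom[OF s] by simp
  also have "\<dots> = \<E> g\<^sub>E (\<lambda>x. u x - s x)" using green_mean_energy[OF d] by simp
  also have "\<dots> = \<E> g\<^sub>E u - \<E> s g\<^sub>E" using diff_right[OF u s g] commute[OF s g] by simp
  also have "\<E> s g\<^sub>E = 0" using s_spline green_mean_dom0 by (auto simp: splines_def dom\<^sub>0_def)
  finally show ?thesis by simp
qed

lemma quadrature_energy_bound:
  assumes u: "u \<in> dom"
  shows "\<bar>(\<integral>x. u x \<partial>\<mu>) - (\<Sum>x\<in>E. spline_weight K F r c \<mu> E x * u x)\<bar>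
    \<le> \<delta>\<^sub>0 K F r c \<mu> E * sqrt (\<E> u u)"
proof -
  have "g\<^sub>E \<in> dom" using green_mean_dom0 by (simp add: dom\<^sub>0_def)
  moreover have "sqrt (\<E> g\<^sub>E g\<^sub>E) = \<delta>\<^sub>0 K F r c \<mu> E"
    using green_mean_energy[OF green_mean_dom0] by (simp add: \<delta>\<^sub>0_def)
  ultimately show ?thesis
    unfolding quadrature_error[OF u] using cauchy_schwarz[of g\<^sub>E u] u by simp
qed

text \<open>The function \<open>g\<^sub>E\<close> vanishes on \<open>E\<close>, hence on \<open>V\<^sub>0\<close> whenever \<open>V\<^sub>0 \<subseteq> E\<close>, so it is an admissible
  test function in the weak definition of the Laplacian of \<open>u\<close> in either case.\<close>

lemma quadrature_laplacian_bound:
  assumes u: "u \<in> dom_L1_laplacian K F r c \<mu> E"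
  shows "\<bar>(\<integral>x. u x \<partial>\<mu>) - (\<Sum>x\<in>E. spline_weight K F r c \<mu> E x * u x)\<bar>
    \<le> \<delta>\<^sub>1 K F r c \<mu> E * (\<integral>x. \<bar>laplacian K F r c \<mu> E u x\<bar> \<partial>\<mu>)"
proof -
  let ?f = "laplacian K F r c \<mu> E u"
  have u_dom: "u \<in> dom" and ex: "\<exists>f. is_laplacian K F r c \<mu> E u f"
    using u by (simp_all add: dom_L1_laplacian_def)
  have lap: "is_laplacian K F r c \<mu> E u ?f"
    unfolding laplacian_def by (rule someI_ex[OF ex])
  then have f: "integrable \<mu> ?f" by (simp add: is_laplacian_def)
  have g: "g\<^sub>E \<in> dom" "\<forall>x\<in>E. g\<^sub>E x = 0" using green_mean_dom0 by (auto simp: dom\<^sub>0_def)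
  then have "V\<^sub>0 \<subseteq> E \<longrightarrow> (\<forall>x\<in>V\<^sub>0. g\<^sub>E x = 0)" by blast
  then have "(\<integral>x. g\<^sub>E x * ?f x \<partial>\<mu>) = - \<E> u g\<^sub>E"
    using lap g(1) unfolding is_laplacian_def by blast
  then have "\<bar>\<E> g\<^sub>E u\<bar> = \<bar>\<integral>x. g\<^sub>E x * ?f x \<partial>\<mu>\<bar>" using commute[OF g(1) u_dom] by simp
  also have "\<dots> \<le> \<delta>\<^sub>1 K F r c \<mu> E * (\<integral>x. \<bar>?f x\<bar> \<partial>\<mu>)"
    using green_mean_nonneg green_mean_le by (intro integral_mult_bound g f) simp
  finally show ?thesis unfolding quadrature_error[OF u_dom] .
qed

end

text \<open>A one-point set would carry an atom.\<close>

lemma admissible_measure_not_singleton: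
  assumes "admissible_measure K \<mu>"
  shows "K \<noteq> {x}"
proof
  assume K: "K = {x}"
  interpret prob_space \<mu> using assms by (simp add: admissible_measure_def)
  have "space \<mu> = K"
    using assms sets_eq_imp_space_eq[of \<mu> "restrict_space borel K"]
    by (simp add: admissible_measure_def space_restrict_space)
  then have "emeasure \<mu> {x} = 1" using emeasure_space_1 K by simp
  moreover have "emeasure \<mu> {x} = 0" using assms K by (simp add: admissible_measure_def)
  ultimately show False by simp
qed

theorem theorem2p6:
  fixes K :: "'a::euclidean_space set"
    and F :: "'i::finite \<Rightarrow> 'a \<Rightarrow> 'a"
    and r :: "'i \<Rightarrow> real"
    and c :: "'a \<Rightarrow> 'a \<Rightarrow> real"
    and \<mu> :: "'a measure"
    and E :: "'a set"
  assumes "pcf_self_similar K F"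
    and "regular_harmonic_structure K F r c"
    and "admissible_measure K \<mu>"
    and "finite E" "E \<noteq> {}" "E \<subseteq> K"
  shows "(\<forall>u\<in>dom_energy K F r c.
            \<bar>(\<integral>x. u x \<partial>\<mu>) - (\<Sum>x\<in>E. spline_weight K F r c \<mu> E x * u x)\<bar>
              \<le> \<delta>\<^sub>0 K F r c \<mu> E * sqrt (energy K F r c u u)) \<and>
         (\<forall>u\<in>dom_L1_laplacian K F r c \<mu> E.
            \<bar>(\<integral>x. u x \<partial>\<mu>) - (\<Sum>x\<in>E. spline_weight K F r c \<mu> E x * u x)\<bar>
              \<le> \<delta>\<^sub>1 K F r c \<mu> E * (\<integral>x. \<bar>laplacian K F r c \<mu> E u x\<bar> \<partial>\<mu>))"
proof -
  interpret set: pcf_set K F by standard (rule assms(1))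
  have "pcf_boundary K F \<noteq> {}"
    by (intro set.boundary_nonempty admissible_measure_not_singleton[OF assms(3)])
  then interpret harmonic_quadrature K F r c \<mu> E
    by unfold_locales (use assms in auto)
  show ?thesis
    using quadrature_energy_bound quadrature_laplacian_bound by blast
qed

end
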